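(* Let $k$ be a commutative ring, $A$ a commutative $k$-algebra, $q\geq2$ an integer, $\Delta\subseteq\mathbb{N}^q$ a co-ideal (possibly infinite), non-empty and different from $\{0\}$, and $D\in \mathrm{HS}^q_k(A;\Delta)$. Denote $m_\beta=m^\Delta_\beta$ for $\beta\in\mathcal{C}^q_\Delta$. Then there exists a unique family $E^\beta\in \mathrm{HS}_k(A;m_\beta)$, $\beta\in\mathcal{C}^q_\Delta$, such that the family $\psi_{\beta,\Delta}\bullet E^\beta$, $\beta\in\mathcal{C}^q_\Delta$, is composable (with respect to the total order $\preceq$ on $\mathcal{C}^q_\Delta$) and $$D=\circ_{\beta\in\mathcal{C}^q_\Delta}\left(\psi_{\beta,\Delta}\bullet E^\beta\right).$$ Moreover, if there is $\alpha=(\alpha_1,\ldots,\alpha_q)\in P^\Delta_\beta$ for some $\beta\in\mathcal{C}^q_\Delta$ such that $D_\gamma=0$ for all $\gamma\in\mathcal{S}^\Delta_\beta$ with $\gamma\leq\alpha$, then $E^\beta_n=D_{n\beta}$ for all $n=0,\ldots,\gcd(\alpha_1,\ldots,\alpha_q)$.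
   Context: Orders. $\mathbb{N}=\{0,1,2,\dots\}$, $\mathbb{N}_+=\mathbb{N}\setminus\{0\}$, $\mathbb{N}^q_+=\mathbb{N}^q\setminus\{(0,\ldots,0)\}$. $\leq$ on $\mathbb{N}^q$ is the componentwise partial order. A co-ideal of $\mathbb{N}^q$ is a subset $\Delta$ such that $\alpha\in\Delta$ and $\alpha'\leq\alpha$ imply $\alpha'\in\Delta$. $\gcd$ denotes the non-negative generator of the ideal of $\mathbb{Z}$ generated by the given integers. For $\alpha,\beta\in\mathbb{N}^q_+$, $\alpha\sim\beta$ iff $\beta=r\alpha$ for some $r\in\mathbb{Q}^\times$; $[\alpha]$ is the class. $\mathcal{C}^q=\{\beta\in\mathbb{N}^q_+ : \gcd(\beta_1,\ldots,\beta_q)=1\}$; each class contains exactly one element $\beta$ of $\mathcal{C}^q$, and $[\beta]=\{r\beta: r\in\mathbb{N}_+\}$. For $\beta\in\mathbb{N}^q$ put $g(\beta)=(0,0)$ if $\beta_1=\beta_2=0$ and $g(\beta)=\frac{1}{\gcd(\beta_1,\beta_2)}(\beta_1,\beta_2)$ otherwise. The total order $\preceq\,=\,\preceq^q$ on $\mathcal{C}^q$ is defined recursively by its strict part: for $q=2$, $\beta\prec^2\gamma$ iff $\gamma_2\beta_1<\gamma_1\beta_2$; for $q\geq3$, $\beta\prec^q\gamma$ iff one of the following holds: (1) $g(\beta)=(0,0)$ and $g(\gamma)\neq(0,0)$; (2) $g(\beta),g(\gamma)\neq(0,0)$ and $g(\beta)\prec^2 g(\gamma)$; (3) $g(\beta)=g(\gamma)$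 and $(\gcd(\beta_1,\beta_2),\beta_3,\ldots,\beta_q)\prec^{q-1}(\gcd(\gamma_1,\gamma_2),\gamma_3,\ldots,\gamma_q)$. Sets attached to $\Delta$. $\mathcal{C}^q_\Delta=\mathcal{C}^q\cap\Delta$. For $\beta\in\mathcal{C}^q_\Delta$: $P^\Delta_\beta=[\beta]\cap\Delta=\{n\beta\in\Delta: n\in\mathbb{N}_+\}$; $m^\Delta_\beta=\#P^\Delta_\beta\in\mathbb{N}_+\cup\{\infty\}$; $\mathcal{S}^\Delta_\beta=\bigsqcup_{\lambda\in\mathcal{C}^q_\Delta,\ \lambda\prec\beta}P^\Delta_\lambda$. HS-derivations. A $\Delta$-variate HS-derivation of $A$ over $k$ is a family $D=(D_\alpha)_{\alpha\in\Delta}$ of $k$-linear maps $A\to A$ with $D_0=\mathrm{Id}_A$ and $D_\alpha(xy)=\sum_{\beta+\gamma=\alpha}D_\beta(x)D_\gamma(y)$ for all $x,y\in A$, $\alpha\in\Delta$. The set of these is $\mathrm{HS}^q_k(A;\Delta)$; it is a group under $(D\circ E)_\alpha=\sum_{\beta+\gamma=\alpha}D_\beta\circ E_\gamma$, with identity $\mathbb{I}$ ($\mathbb{I}_0=\mathrm{Id}$, $\mathbb{I}_\alpha=0$ for $\alpha\ne0$). For $m\in\mathbb{N}_+\cup\{\infty\}$, $\mathrm{HS}_k(A;m)=\mathrm{HS}^1_k(A;\{n\in\mathbb{N}: n\leq m\})$. For non-empty co-ideals $\Delta'\subset\Delta$, the truncation $\tau_{\Delta\Delta'}:\mathrm{HS}^q_k(A;\Delta)\to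 \mathrm{HS}^q_k(A;\Delta')$, $(D_\alpha)_{\alpha\in\Delta}\mapsto(D_\alpha)_{\alpha\in\Delta'}$, is a group homomorphism. Substitution maps. For variables $\mathbf{s}=\{s_1,\dots,s_q\}$, $A[[\mathbf{s}]]_\Delta$ is the quotient of $A[[\mathbf{s}]]$ by the ideal of power series whose coefficients at all $\mathbf{s}^\alpha$, $\alpha\in\Delta$, vanish; $A[[\mu]]_m=A[[\mu]]_{\{n\in\mathbb{N}:n\leq m\}}$. For $\beta\in\mathcal{C}^q_\Delta$, $\psi_{\beta,\Delta}:A[[\mu]]_{m^\Delta_\beta}\to A[[\mathbf{s}]]_\Delta$ is the continuous $A$-algebra map with $\mu\mapsto s_1^{\beta_1}\cdots s_q^{\beta_q}$. An HS-derivation $E=(E_r)$ is identified with the series $\sum_r E_r\mu^r$, and $\psi_{\beta,\Delta}\bullet E=\sum_r\psi_{\beta,\Delta}(\mu^r)E_r\in \mathrm{HS}^q_k(A;\Delta)$; i.e. its component at $r\beta\in\Delta$ is $E_r$ and its other components are $0$. Composable families. Let $(I,\preceq)$ be a totally ordered set and $(r_i)_{i\in I}$ a family in $\mathrm{HS}^q_k(A;\Delta)$. It is composable if for each finite co-ideal $\Delta'\subset\Delta$ the set $I_{\Delta'}=\{i\in I:\tau_{\Delta\Delta'}(r_i)\neq\mathbb{I}\}$ is finite. Then its ordered composition $\circ_{i\in I}r_i$ is the unique element of $\mathrm{HS}^q_k(A;\Delta)$ whose truncation to each finite non-empty co-ideal $\Delta'\subset\Delta$ is $\tau_{\Delta\Delta'}(r_{i_1})\circ\cdots\circ\tau_{\Delta\Delta'}(r_{i_l})$,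 where $I_{\Delta'}=\{i_1\prec\cdots\prec i_l\}$. *)

theory Defs
  imports "HOL-Library.FuncSet" "HOL-Library.Extended_Nat"
begin

text \<open>
  Elements of \<open>\<nat>\<^sup>q\<close> are lists of length \<open>q\<close>; this allows the recursion on \<open>q\<close> in the
  definition of the order on primitive vectors.
\<close>

abbreviation vec_zero :: "nat \<Rightarrow> nat list" where
  "vec_zero q \<equiv> replicate q 0"

abbreviation vec_add :: "nat list \<Rightarrow> nat list \<Rightarrow> nat list" where
  "vec_add \<equiv> map2 (+)"

abbreviation vec_smult :: "nat \<Rightarrow> nat list \<Rightarrow> nat list" where
  "vec_smult n \<equiv> map ((*) n)"

abbreviation vec_le :: "nat list \<Rightarrow> nat list \<Rightarrow> bool" where
  "vec_le \<equiv> list_all2 (\<le>)"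

definition coideal :: "nat \<Rightarrow> nat list set \<Rightarrow> bool" where
  "coideal q \<Delta> \<longleftrightarrow>
     \<Delta> \<subseteq> {\<alpha>. length \<alpha> = q} \<and> (\<forall>\<alpha>\<in>\<Delta>. \<forall>\<alpha>'. vec_le \<alpha>' \<alpha> \<longrightarrow> \<alpha>' \<in> \<Delta>)"

definition primitive :: "nat \<Rightarrow> nat list set" where
  "primitive q = {\<beta>. length \<beta> = q \<and> \<beta> \<noteq> vec_zero q \<and> Gcd (set \<beta>) = 1}"

fun reduced_pair :: "nat \<Rightarrow> nat \<Rightarrow> nat \<times> nat" where
  "reduced_pair a b = (if a = 0 \<and> b = 0 then (0, 0) else (a div gcd a b, b div gcd a b))"

fun prec_pair :: "nat \<times> nat \<Rightarrow> nat \<times> nat \<Rightarrow> bool" where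
  "prec_pair (b1, b2) (c1, c2) \<longleftrightarrow> c2 * b1 < c1 * b2"

text \<open>The strict order; it is only meaningful on \<^term>\<open>primitive q\<close> for \<open>q \<ge> 2\<close>.\<close>

fun prec :: "nat list \<Rightarrow> nat list \<Rightarrow> bool" where
  "prec [b1, b2] [c1, c2] \<longleftrightarrow> prec_pair (b1, b2) (c1, c2)"
| "prec (b1 # b2 # b3 # bs) (c1 # c2 # c3 # cs) \<longleftrightarrow>
     (reduced_pair b1 b2 = (0, 0) \<and> reduced_pair c1 c2 \<noteq> (0, 0)) \<or>
     (reduced_pair b1 b2 \<noteq> (0, 0) \<and> reduced_pair c1 c2 \<noteq> (0, 0) \<and>
        prec_pair (reduced_pair b1 b2) (reduced_pair c1 c2)) \<or>
     (reduced_pair b1 b2 = reduced_pair c1 c2 \<and>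
        prec (gcd b1 b2 # b3 # bs) (gcd c1 c2 # c3 # cs))"
| "prec _ _ \<longleftrightarrow> False"

definition ray :: "nat list set \<Rightarrow> nat list \<Rightarrow> nat list set" where
  "ray \<Delta> \<beta> = {vec_smult n \<beta> | n. 0 < n} \<inter> \<Delta>"

definition ray_card :: "nat list set \<Rightarrow> nat list \<Rightarrow> enat" where
  "ray_card \<Delta> \<beta> = (if finite (ray \<Delta> \<beta>) then enat (card (ray \<Delta> \<beta>)) else \<infinity>)"

definition below :: "nat \<Rightarrow> nat list set \<Rightarrow> nat list \<Rightarrow> nat list set" where
  "below q \<Delta> \<beta> = (\<Union>\<nu>\<in>{\<nu> \<in> primitive q \<inter> \<Delta>. prec \<nu> \<beta>}. ray \<Delta> \<nu>)"

text \<open>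
  Commutative unital algebras. The sort \<open>{comm_ring, comm_monoid_mult}\<close> is that of commutative
  rings with unit; unlike \<^class>\<open>comm_ring_1\<close> it does not exclude the zero ring.
\<close>

locale comm_algebra =
  fixes scale :: "'k::{comm_ring, comm_monoid_mult} \<Rightarrow> 'a::{comm_ring, comm_monoid_mult} \<Rightarrow> 'a"
  assumes scale_add_right: "scale c (x + y) = scale c x + scale c y"
    and scale_add_left: "scale (c + d) x = scale c x + scale d x"
    and scale_scale: "scale c (scale d x) = scale (c * d) x"
    and scale_one: "scale 1 x = x"
    and scale_mult_left: "scale c (x * y) = scale c x * y"

definition klinear :: "('k \<Rightarrow> 'a \<Rightarrow> 'a) \<Rightarrow> ('a::ab_group_add \<Rightarrow> 'a) \<Rightarrow> bool" where
  "klinear scale f \<longleftrightarrow> (\<forall>x y. f (x + y) = f x + f y) \<and> (\<forall>c x. f (scale c x) = scale c (f x))"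

definition splits :: "nat list \<Rightarrow> (nat list \<times> nat list) set" where
  "splits \<alpha> = {(\<beta>, \<gamma>). length \<beta> = length \<alpha> \<and> length \<gamma> = length \<alpha> \<and> vec_add \<beta> \<gamma> = \<alpha>}"

text \<open>
  Families indexed by \<open>\<Delta>\<close> are extensional functions (equal to \<^const>\<open>undefined\<close> off \<open>\<Delta>\<close>), so that
  families are equal iff they are equal as functions, and the truncation to \<open>\<Delta>' \<subseteq> \<Delta>\<close> is
  \<open>restrict D \<Delta>'\<close>.
\<close>

definition HS :: "('k \<Rightarrow> 'a \<Rightarrow> 'a) \<Rightarrow> nat \<Rightarrow> nat list set \<Rightarrow>
    (nat list \<Rightarrow> 'a::{comm_ring, comm_monoid_mult} \<Rightarrow> 'a) set" where
  "HS scale q \<Delta> = {D \<in> extensional \<Delta>.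
     (\<forall>\<alpha>\<in>\<Delta>. klinear scale (D \<alpha>)) \<and>
     D (vec_zero q) = id \<and>
     (\<forall>\<alpha>\<in>\<Delta>. \<forall>x y. D \<alpha> (x * y) = (\<Sum>(\<beta>, \<gamma>)\<in>splits \<alpha>. D \<beta> x * D \<gamma> y))}"

definition HS_comp :: "nat list set \<Rightarrow> (nat list \<Rightarrow> 'a \<Rightarrow> 'a) \<Rightarrow> (nat list \<Rightarrow> 'a \<Rightarrow> 'a) \<Rightarrow>
    nat list \<Rightarrow> 'a::comm_monoid_add \<Rightarrow> 'a" where
  "HS_comp \<Delta> D E = (\<lambda>\<alpha>\<in>\<Delta>. \<lambda>x. \<Sum>(\<beta>, \<gamma>)\<in>splits \<alpha>. D \<beta> (E \<gamma> x))"

definition HS_one :: "nat list set \<Rightarrow> nat list \<Rightarrow> 'a::zero \<Rightarrow> 'a" where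
  "HS_one \<Delta> = (\<lambda>\<alpha>\<in>\<Delta>. if \<alpha> = vec_zero (length \<alpha>) then id else (\<lambda>x. 0))"

text \<open>One-variate derivations of length \<open>m\<close>; their components are \<open>E [0], E [1], \<dots>\<close>.\<close>

definition HS1 :: "('k \<Rightarrow> 'a \<Rightarrow> 'a) \<Rightarrow> enat \<Rightarrow>
    (nat list \<Rightarrow> 'a::{comm_ring, comm_monoid_mult} \<Rightarrow> 'a) set" where
  "HS1 scale m = HS scale 1 {[n] | n. enat n \<le> m}"

text \<open>
  The action on \<open>E = \<Sum>\<^sub>r E\<^sub>r \<mu>\<^sup>r\<close> of the substitution \<open>\<mu> \<mapsto> s\<^sup>\<beta>\<close> into series truncated to \<open>\<Delta>\<close>: the
  component at \<open>\<alpha>\<close> is the coefficient of \<open>s\<^sup>\<alpha>\<close> in \<open>\<Sum>\<^sub>r E\<^sub>r s\<^bsup>r\<beta>\<^esup>\<close>. As \<open>\<beta> \<noteq> 0\<close>, the sum below has one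
  term if \<open>\<alpha> \<in> \<nat>\<beta>\<close> and none otherwise; and \<open>r\<beta> \<in> \<Delta>\<close> implies \<open>r \<le> ray_card \<Delta> \<beta>\<close>.
\<close>

definition psi_act :: "nat list set \<Rightarrow> nat list \<Rightarrow> (nat list \<Rightarrow> 'a \<Rightarrow> 'a) \<Rightarrow>
    nat list \<Rightarrow> 'a::comm_monoid_add \<Rightarrow> 'a" where
  "psi_act \<Delta> \<beta> E = (\<lambda>\<alpha>\<in>\<Delta>. \<lambda>x. \<Sum>r | vec_smult r \<beta> = \<alpha>. E [r] x)"

lemma psi_act_component:
  assumes "\<beta> \<noteq> vec_zero (length \<beta>)" "\<alpha> \<in> \<Delta>"
  shows "\<alpha> = vec_smult r \<beta> \<Longrightarrow> psi_act \<Delta> \<beta> E \<alpha> = E [r]"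
    and "\<nexists>r. \<alpha> = vec_smult r \<beta> \<Longrightarrow> psi_act \<Delta> \<beta> E \<alpha> = (\<lambda>x. 0)"
proof -
  obtain b where b: "b \<in> set \<beta>" "b \<noteq> 0"
    using assms(1) replicate_eqI[of \<beta> "length \<beta>" 0] by auto
  have inj: "r' = r" if "vec_smult r' \<beta> = vec_smult r \<beta>" for r r'
  proof -
    have "r' * b = r * b"
      using that b(1) by (simp only: map_eq_conv)
    then show ?thesis
      using b(2) by simp
  qed
  show "psi_act \<Delta> \<beta> E \<alpha> = E [r]" if "\<alpha> = vec_smult r \<beta>"
  proof -
    have "{r'. vec_smult r' \<beta> = vec_smult r \<beta>} = {r}"
      using inj by blast
    then show ?thesis
      using that assms(2) by (simp add: psi_act_def)
  qed
  show "psi_act \<Delta> \<beta> E \<alpha> = (\<lambda>x. 0)" if "\<nexists>r. \<alpha> = vec_smult r \<beta>"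
  proof -
    have "{r. vec_smult r \<beta> = \<alpha>} = {}"
      using that by blast
    then show ?thesis
      using assms(2) by (simp add: psi_act_def)
  qed
qed

definition nontrivial_on :: "nat list set \<Rightarrow> 'i set \<Rightarrow>
    ('i \<Rightarrow> nat list \<Rightarrow> 'a::zero \<Rightarrow> 'a) \<Rightarrow> 'i set" where
  "nontrivial_on \<Delta>' I R = {i \<in> I. restrict (R i) \<Delta>' \<noteq> HS_one \<Delta>'}"

definition composable :: "('k \<Rightarrow> 'a \<Rightarrow> 'a) \<Rightarrow> nat \<Rightarrow> nat list set \<Rightarrow> 'i set \<Rightarrow>
    ('i \<Rightarrow> nat list \<Rightarrow> 'a::{comm_ring, comm_monoid_mult} \<Rightarrow> 'a) \<Rightarrow> bool" where
  "composable scale q \<Delta> I R \<longleftrightarrow> (\<forall>i\<in>I. R i \<in> HS scale q \<Delta>) \<and>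
     (\<forall>\<Delta>'. coideal q \<Delta>' \<and> finite \<Delta>' \<and> \<Delta>' \<subseteq> \<Delta> \<longrightarrow> finite (nontrivial_on \<Delta>' I R))"

text \<open>
  \<open>ordered_comp scale q \<Delta> lt I R\<close> is the composition of a composable family \<open>R\<close> over \<open>I\<close>, where
  \<open>lt\<close> is a strict total order on \<open>I\<close>; \<open>xs\<close> is then the increasing enumeration of the indices
  with nontrivial truncation.
\<close>

definition ordered_comp :: "('k \<Rightarrow> 'a \<Rightarrow> 'a) \<Rightarrow> nat \<Rightarrow> nat list set \<Rightarrow>
    ('i \<Rightarrow> 'i \<Rightarrow> bool) \<Rightarrow> 'i set \<Rightarrow> ('i \<Rightarrow> nat list \<Rightarrow> 'a \<Rightarrow> 'a) \<Rightarrow>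
    nat list \<Rightarrow> 'a::{comm_ring, comm_monoid_mult} \<Rightarrow> 'a" where
  "ordered_comp scale q \<Delta> lt I R = (THE D. D \<in> HS scale q \<Delta> \<and>
     (\<forall>\<Delta>'. coideal q \<Delta>' \<and> finite \<Delta>' \<and> \<Delta>' \<noteq> {} \<and> \<Delta>' \<subseteq> \<Delta> \<longrightarrow>
        (\<exists>xs. set xs = nontrivial_on \<Delta>' I R \<and> sorted_wrt lt xs \<and>
           restrict D \<Delta>' = foldr (\<lambda>i. HS_comp \<Delta>' (restrict (R i) \<Delta>')) xs (HS_one \<Delta>'))))"

definition is_factorization :: "('k \<Rightarrow> 'a \<Rightarrow> 'a) \<Rightarrow> nat \<Rightarrow> nat list set \<Rightarrow>
    (nat list \<Rightarrow> 'a::{comm_ring, comm_monoid_mult} \<Rightarrow> 'a) \<Rightarrow>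
    (nat list \<Rightarrow> nat list \<Rightarrow> 'a \<Rightarrow> 'a) \<Rightarrow> bool" where
  "is_factorization scale q \<Delta> D E \<longleftrightarrow>
     E \<in> (\<Pi>\<^sub>E \<beta>\<in>primitive q \<inter> \<Delta>. HS1 scale (ray_card \<Delta> \<beta>)) \<and>
     composable scale q \<Delta> (primitive q \<inter> \<Delta>) (\<lambda>\<beta>. psi_act \<Delta> \<beta> (E \<beta>)) \<and>
     D = ordered_comp scale q \<Delta> prec (primitive q \<inter> \<Delta>) (\<lambda>\<beta>. psi_act \<Delta> \<beta> (E \<beta>))"

end

theory Submission
  imports Defs
begin

text \<open>
  The order is compatible with addition: for a primitive \<open>\<beta>\<close> the sets
  \<open>{\<gamma>. \<beta> \<prec> \<gamma>}\<close> and \<open>{\<gamma>. \<beta> \<preceq> \<gamma>}\<close> are additively closed (for the evident extension of the order to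
  non-primitive vectors), and a sum of two members of the second one lies on the ray of \<open>\<beta>\<close> only if
  both summands do. Hence, if \<open>\<beta>\<close> is the smallest primitive vector in the support of \<open>D\<close>, then
  \<open>E\<^sub>n = D\<^bsub>n\<beta>\<^esub>\<close> is a one-variate HS-derivation, and dividing \<open>D\<close> on the left by \<open>\<psi>\<^sub>\<beta> \<bullet> E\<close> leaves an
  HS-derivation supported strictly above \<open>\<beta>\<close>. On a finite co-ideal this peels off all factors, and
  it shows that they are forced. For arbitrary \<open>\<Delta>\<close>, the factorizations over the boxes
  \<open>{\<gamma>. \<gamma> \<le> \<alpha>}\<close> are glued by uniqueness.
\<close>

section \<open>Primitive vectors and their order\<close>

text \<open>The recursion through greatest common divisors hides why the order respects sums. After
  division by the leading entries, each comparison becomes a linear inequality in the larger vector,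
  and closure under addition is immediate. Sums and multiples of primitive vectors need not be
  primitive, so the order has to be extended to all vectors before this can be used.

  For infinite \<Delta> no direct induction over rays is possible: the primitive vectors of \<nat>^2
  are ordered like the slopes from infinity down to 0, so after the first ray there is no next one,
  and there is no list of rays to fold over. A box, however, contains only finitely many primitive
  vectors. Every positive multiple of \<beta> dominates \<beta>, so a co-ideal that misses \<beta>
  meets its ray at most in 0. Enlarging a box therefore only inserts factors that are trivial on the
  smaller box, and the n-th component of the factor at \<beta> is already determined on the box
  below n\<beta>.\<close>

lemma vec_add_assoc: "vec_add (vec_add \<alpha> \<beta>) \<gamma> = vec_add \<alpha> (vec_add \<beta> \<gamma>)"
  by (rule nth_equalityI) auto

lemma vec_add_commute: "vec_add \<alpha> \<beta> = vec_add \<beta> (\<alpha> :: nat list)"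
  by (rule nth_equalityI) auto

lemma vec_add_zero: "length \<alpha> = n \<Longrightarrow> vec_add \<alpha> (vec_zero n) = \<alpha>"
  by (rule nth_equalityI) auto

lemma vec_le_add: "length \<beta> = length \<gamma> \<Longrightarrow> vec_le \<beta> (vec_add \<beta> \<gamma>)"
  by (simp add: list_all2_conv_all_nth)

lemma vec_add_smult: "vec_add (vec_smult m \<beta>) (vec_smult n \<beta>) = vec_smult (m + n) \<beta>"
  by (rule nth_equalityI) (auto simp: algebra_simps)

lemma sum_list_vec_add:
  "length \<beta> = length \<gamma> \<Longrightarrow> sum_list (vec_add \<beta> \<gamma>) = sum_list \<beta> + sum_list (\<gamma> :: nat list)"
  by (induction \<beta> \<gamma> rule: list_induct2) auto

lemma sum_list_pos: "\<beta> \<noteq> vec_zero (length \<beta>) \<Longrightarrow> 0 < sum_list (\<beta> :: nat list)"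
  by (induction \<beta>) auto

lemma vec_le_refl: "vec_le \<alpha> \<alpha>"
  by (simp add: list_all2_conv_all_nth)

lemma vec_le_trans: "vec_le \<alpha> \<beta> \<Longrightarrow> vec_le \<beta> \<gamma> \<Longrightarrow> vec_le \<alpha> \<gamma>"
  by (rule list_all2_trans[of "(\<le>)" "(\<le>)" "(\<le>)"]) auto

lemma primitiveD:
  assumes "\<beta> \<in> primitive q"
  shows "length \<beta> = q" "\<beta> \<noteq> vec_zero (length \<beta>)"
  using assms by (auto simp: primitive_def)

lemma smult_zero: "length \<beta> = q \<Longrightarrow> vec_smult 0 \<beta> = vec_zero q"
  by (rule nth_equalityI) auto

lemma inj_vec_smult: "\<beta> \<noteq> vec_zero (length \<beta>) \<Longrightarrow> inj (\<lambda>n. vec_smult n \<beta>)"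
proof (rule injI)
  fix m n
  assume "\<beta> \<noteq> vec_zero (length \<beta>)" "vec_smult m \<beta> = vec_smult n \<beta>"
  then show "m = n"
    using replicate_eqI[of \<beta> "length \<beta>" 0] by auto
qed

lemma vec_le_smult: "m \<le> n \<Longrightarrow> vec_le (vec_smult m \<beta>) (vec_smult n \<beta>)"
  by (simp add: list_all2_conv_all_nth)

lemma multiple_of_primitive:
  assumes "length \<gamma> = q" "\<gamma> \<noteq> vec_zero q"
  obtains \<beta> n where "\<beta> \<in> primitive q" "0 < n" "\<gamma> = vec_smult n \<beta>"
proof -
  define g where "g = Gcd (set \<gamma>)"
  define \<beta> where "\<beta> = map (\<lambda>a. a div g) \<gamma>"
  obtain b where "b \<in> set \<gamma>" "b \<noteq> 0"
    using assms replicate_eqI[of \<gamma> q 0] by auto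
  then have g: "0 < g"
    unfolding g_def by (metis Gcd_0_iff gr0I singletonD subsetD)
  have dvd: "g dvd a" if "a \<in> set \<gamma>" for a
    using that by (simp add: g_def)
  have \<gamma>: "\<gamma> = vec_smult g \<beta>"
    unfolding \<beta>_def using dvd by (simp add: map_idI)
  have "g = g * Gcd (set \<beta>)"
    using g_def Gcd_mult[of g "set \<beta>"] by (simp add: \<gamma>)
  then have "Gcd (set \<beta>) = 1"
    using g by simp
  moreover have "length \<beta> = q"
    using assms(1) by (simp add: \<beta>_def)
  moreover have "\<beta> \<noteq> vec_zero q"
  proof
    assume "\<beta> = vec_zero q"
    then have "vec_smult g \<beta> = vec_zero q"
      by simp
    then show False
      using \<gamma> assms(2) by simp
  qed
  ultimately have "\<beta> \<in> primitive q"
    by (simp add: primitive_def)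
  from that[OF this g \<gamma>] show thesis .
qed

text \<open>
  Dividing a nonzero vector by its first nonzero entry turns \<^const>\<open>prec\<close> into the reversed
  lexicographic order, vectors with more leading zeros coming first; here \<open>a\<close> and \<open>b\<close> are the leading
  entries and denominators are cleared. The flag is the value returned for proportional vectors, so
  \<open>cone False\<close> is the strict and \<open>cone True\<close> the weak order.
\<close>

fun lex_cone :: "bool \<Rightarrow> nat \<Rightarrow> nat \<Rightarrow> nat list \<Rightarrow> nat list \<Rightarrow> bool" where
  "lex_cone s a b (x # xs) (y # ys) \<longleftrightarrow> a * y < b * x \<or> a * y = b * x \<and> lex_cone s a b xs ys"
| "lex_cone s _ _ _ _ \<longleftrightarrow> s"

fun cone :: "bool \<Rightarrow> nat list \<Rightarrow> nat list \<Rightarrow> bool" where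
  "cone s (x # xs) (y # ys) \<longleftrightarrow>
     (if x = 0 then y \<noteq> 0 \<or> cone s xs ys else lex_cone s x y xs ys)"
| "cone s _ _ \<longleftrightarrow> s"

text \<open>For fixed \<open>a\<close> and \<open>xs\<close>, each comparison is linear in the other
  leading entry and the current entry of the other tail, so two of them can be added. A strict
  inequality in one summand survives the addition. This explains the conjunction of the flags: a sum
  is on the boundary only if both summands are.\<close>

lemma lex_cone_add:
  assumes "lex_cone s a b xs ys" "lex_cone t a c xs zs"
    and "length xs = length ys" "length ys = length zs"
  shows "lex_cone (s \<and> t) a (b + c) xs (vec_add ys zs)"
  using assms(3,4,1,2)
proof (induction xs ys zs rule: list_induct3)
  case (Cons x xs y ys z zs)
  then show ?case
    by (auto simp: algebra_simps)
qed simp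

lemma cone_add:
  assumes "cone s \<beta> \<gamma>" "cone t \<beta> \<delta>" "length \<beta> = length \<gamma>" "length \<gamma> = length \<delta>"
  shows "cone (s \<and> t) \<beta> (vec_add \<gamma> \<delta>)"
  using assms(3,4,1,2)
proof (induction \<beta> \<gamma> \<delta> rule: list_induct3)
  case (Cons x xs y ys z zs)
  then show ?case
    using lex_cone_add[of s x y xs ys t z zs] by auto
qed simp

lemma lex_cone_smult [simp]: "lex_cone s a (n * a) xs (vec_smult n xs) = s"
  by (induction xs) auto

lemma cone_smult [simp]: "cone s \<beta> (vec_smult n \<beta>) = s"
  by (induction \<beta>) auto

text \<open>Only the ratio of the leading entries matters. This absorbs the replacement of two
  entries by their gcd in the recursion of \<open>prec\<close>.\<close>

lemma lex_cone_scale: "0 < g \<Longrightarrow> lex_cone s (g * a) (g * b) xs ys = lex_cone s a b xs ys"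
  by (induction s a b xs ys rule: lex_cone.induct) (auto simp: mult.assoc)

lemma lex_cone_0 [simp]: "\<not> lex_cone False a 0 xs ys"
  by (induction xs ys rule: list_induct2') auto

lemma lex_cone_trans:
  assumes "lex_cone False a b xs ys" "lex_cone False b c ys zs"
    and "length xs = length ys" "length ys = length zs" "0 < a" "0 < b" "0 < c"
  shows "lex_cone False a c xs zs"
  using assms(3,4,1,2)
proof (induction xs ys zs rule: list_induct3)
  case (Cons x xs y ys z zs)
  have le: "a * y \<le> b * x" "b * z \<le> c * y"
    using Cons.prems by auto
  then have "a * (b * z) \<le> a * (c * y)" "c * (a * y) \<le> c * (b * x)"
    by simp_all
  then have m: "b * (a * z) \<le> c * (a * y)" "c * (a * y) \<le> b * (c * x)"
    by (simp_all add: ac_simps)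
  then have "a * z \<le> c * x"
    using \<open>0 < b\<close> by (metis le_trans mult_le_cancel1)
  \<comment> \<open>A tie at this entry in the composed comparison forces ties in both given ones,
    so all three comparisons pass to the tails together.\<close>
  moreover have "a * y = b * x \<and> b * z = c * y" if "a * z = c * x"
  proof -
    have "c * (a * y) = b * (c * x)" "b * (a * z) = c * (a * y)"
      using m that by auto
    then have "c * (a * y) = c * (b * x)" "a * (b * z) = a * (c * y)"
      by (simp_all add: ac_simps)
    then show ?thesis
      using \<open>0 < a\<close> \<open>0 < c\<close> by simp
  qed
  ultimately show ?case
    using Cons by auto
qed simp

lemma cone_trans:
  assumes "cone False \<alpha> \<beta>" "cone False \<beta> \<gamma>" "length \<alpha> = length \<beta>" "length \<beta> = length \<gamma>"
  shows "cone False \<alpha> \<gamma>"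
  using assms(3,4,1,2)
proof (induction \<alpha> \<beta> \<gamma> rule: list_induct3)
  case (Cons x xs y ys z zs)
  consider "x = 0" | "0 < x" "y = 0" | "0 < x" "0 < y" "z = 0" | "0 < x" "0 < y" "0 < z"
    by blast
  then show ?case
  proof cases
    case 1
    then show ?thesis
      using Cons.prems Cons.IH by (cases "y = 0"; cases "z = 0") simp_all
  next
    case 4
    then have "lex_cone False x z xs zs"
      using Cons.prems Cons.hyps by (intro lex_cone_trans[of x y xs ys z zs]) simp_all
    then show ?thesis
      using 4 by simp
  qed (use Cons.prems in simp_all)
qed simp

lemma lex_cone_linear:
  "length xs = length ys \<Longrightarrow> \<not> lex_cone s a b xs ys \<Longrightarrow> lex_cone (\<not> s) b a ys xs"
  by (induction xs ys rule: list_induct2) auto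

lemma cone_linear: "length \<beta> = length \<gamma> \<Longrightarrow> \<not> cone s \<beta> \<gamma> \<Longrightarrow> cone (\<not> s) \<gamma> \<beta>"
  by (induction \<beta> \<gamma> rule: list_induct2) (auto simp: lex_cone_linear split: if_splits)

lemma lex_cone_proportional:
  "length xs = length ys \<Longrightarrow> lex_cone True a b xs ys \<Longrightarrow> \<not> lex_cone False a b xs ys \<Longrightarrow>
     vec_smult a ys = vec_smult b xs"
  by (induction xs ys rule: list_induct2) auto

text \<open>Weak but not strict membership means that every comparison ended in a tie, so all cross
  products agree. Leading zeros of \<beta> are then matched by zeros of \<gamma>, and after them the
  two leading entries serve as the multipliers.\<close>

lemma cone_proportional:
  "length \<beta> = length \<gamma> \<Longrightarrow> \<beta> \<noteq> vec_zero (length \<beta>) \<Longrightarrow> cone True \<beta> \<gamma> \<Longrightarrow> \<not> cone False \<beta> \<gamma> \<Longrightarrow>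
     \<exists>m n. 0 < m \<and> vec_smult m \<gamma> = vec_smult n \<beta>"
proof (induction \<beta> \<gamma> rule: list_induct2)
  case (Cons x xs y ys)
  show ?case
  proof (cases "x = 0")
    case True
    then show ?thesis
      using Cons by auto
  next
    case False
    then show ?thesis
      using Cons lex_cone_proportional[of xs ys x y]
      by (intro exI[of _ x] exI[of _ y]) auto
  qed
qed simp

text \<open>The gcd of the entries of n\<beta> is n, so m divides n and can be cancelled.\<close>

lemma primitive_multiple:
  assumes "\<beta> \<in> primitive q" "vec_smult m \<gamma> = vec_smult n \<beta>" "0 < m"
  obtains r where "\<gamma> = vec_smult r \<beta>"
proof -
  have "m dvd Gcd ((*) n ` set \<beta>)"
  proof (rule Gcd_greatest)
    fix b
    assume "b \<in> (*) n ` set \<beta>"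
    then have "b \<in> set (vec_smult m \<gamma>)"
      using assms(2) by simp
    then show "m dvd b"
      by auto
  qed
  then have "m dvd n"
    using assms(1) by (simp add: Gcd_mult primitive_def)
  then obtain r where "n = m * r" ..
  then have "map ((*) m) \<gamma> = map ((*) m) (vec_smult r \<beta>)"
    using assms(2) by (simp add: mult.assoc)
  then have "\<gamma> = vec_smult r \<beta>"
    using inj_map_eq_map[of "(*) m"] \<open>0 < m\<close> by (simp add: inj_on_def del: map_map)
  then show thesis ..
qed

text \<open>The boundary of the weak cone consists of vectors proportional to \<beta>, and
  primitivity makes the factor an integer. The factor 0 is included, since the zero vector lies on
  the boundary.\<close>

lemma cone_True_cases:
  assumes "\<beta> \<in> primitive q" "length \<gamma> = q" "cone True \<beta> \<gamma>"
  shows "cone False \<beta> \<gamma> \<or> (\<exists>r. \<gamma> = vec_smult r \<beta>)"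
proof (cases "cone False \<beta> \<gamma>")
  case False
  then obtain m n where "0 < m" "vec_smult m \<gamma> = vec_smult n \<beta>"
    using cone_proportional[of \<beta> \<gamma>] assms by (auto simp: primitive_def)
  then show ?thesis
    using primitive_multiple[OF assms(1)] by blast
qed simp

lemma cone_irrefl: "\<not> cone False \<beta> \<beta>"
  using cone_smult[of False \<beta> 1] by (simp add: map_idI)

lemma primitive_smult_eq:
  assumes "\<beta> \<in> primitive q" "\<gamma> \<in> primitive q" "\<gamma> = vec_smult r \<beta>"
  shows "\<gamma> = \<beta>"
proof -
  have "Gcd (set \<gamma>) = r * Gcd (set \<beta>)"
    using assms(3) by (simp add: Gcd_mult)
  then show ?thesis
    using assms by (simp add: primitive_def map_idI)
qed

lemma primitive_cone_total:
  assumes "\<beta> \<in> primitive q" "\<gamma> \<in> primitive q" "\<beta> \<noteq> \<gamma>" "\<not> cone False \<gamma> \<beta>"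
  shows "cone False \<beta> \<gamma>"
proof -
  have "length \<gamma> = q" "length \<beta> = q"
    using assms by (simp_all add: primitive_def)
  then have "cone True \<beta> \<gamma>"
    using assms(4) cone_linear[of \<gamma> \<beta> False] by simp
  then consider "cone False \<beta> \<gamma>" | r where "\<gamma> = vec_smult r \<beta>"
    using cone_True_cases[OF assms(1) \<open>length \<gamma> = q\<close>] by fast
  then show ?thesis
    using primitive_smult_eq[OF assms(1,2)] assms(3) by cases auto
qed

text \<open>Write (b1, b2) = g(u, v) and (c1, c2) = h(w, z) in lowest terms. Comparing the reduced
  pairs is the same as comparing the original ones, up to the factor gh. A tie forces u = w and v =
  z by coprimality, and the leading entries g and h of the shorter vectors then differ from b1 and
  c1 by the common factor u.\<close>

lemma prec_iff_cone:
  "length \<beta> = length \<gamma> \<Longrightarrow> 2 \<le> length \<beta> \<Longrightarrow> \<beta> \<noteq> vec_zero (length \<beta>) \<Longrightarrow> \<gamma> \<noteq> vec_zero (length \<gamma>) \<Longrightarrow>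
    prec \<beta> \<gamma> = cone False \<beta> \<gamma>"
proof (induction \<beta> \<gamma> rule: prec.induct)
  case (2 b1 b2 b3 bs c1 c2 c3 cs)
  have IH: "prec (gcd b1 b2 # b3 # bs) (gcd c1 c2 # c3 # cs) =
      cone False (gcd b1 b2 # b3 # bs) (gcd c1 c2 # c3 # cs)"
    by (rule "2.IH") (use "2.prems" in auto)
  show ?case
  proof (cases "b1 = 0 \<or> c1 = 0")
    \<comment> \<open>A zero first entry makes the reduced pair (0, 0) or (0, 1). The test on
      leading zeros in \<open>cone\<close> then reproduces the clauses about (0, 0).\<close>
    case True
    moreover have "0 < b1 div gcd b1 b2" if "0 < b1"
      using that by (simp add: div_greater_zero_iff)
    moreover have "0 < c1 div gcd c1 c2" if "0 < c1"
      using that by (simp add: div_greater_zero_iff)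
    ultimately show ?thesis
      using IH by (cases "b1 = 0"; cases "c1 = 0"; cases "b2 = 0"; cases "c2 = 0") simp_all
  next
    case False
    define g h where "g = gcd b1 b2" and "h = gcd c1 c2"
    then have gh: "0 < g" "0 < h"
      using False by auto
    obtain u v where u: "b1 = g * u" "b2 = g * v" "coprime u v"
      using gcd_coprime_exists[of b1 b2] gh unfolding g_def by (metis mult.commute less_numeral_extra(3))
    obtain w z where w: "c1 = h * w" "c2 = h * z" "coprime w z"
      using gcd_coprime_exists[of c1 c2] gh unfolding h_def by (metis mult.commute less_numeral_extra(3))
    have red: "reduced_pair b1 b2 = (u, v)" "reduced_pair c1 c2 = (w, z)"
      using False gh u(1,2) w(1,2) unfolding reduced_pair.simps g_def[symmetric] h_def[symmetric]
      by simp_all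
    have pos: "0 < u" "0 < w"
      using u w False by auto
    have eq: "z * u = w * v \<longleftrightarrow> u = w \<and> v = z"
      using coprime_crossproduct_nat[OF u(3) w(3)] by (metis mult.commute)
    have IH: "prec (g # b3 # bs) (h # c3 # cs) = lex_cone False g h (b3 # bs) (c3 # cs)"
      using IH gh by (simp add: g_def[symmetric] h_def[symmetric] del: lex_cone.simps)
    have sc: "lex_cone False g h (b3 # bs) (c3 # cs) = lex_cone False b1 c1 (b3 # bs) (c3 # cs)" if "u = w"
      using lex_cone_scale[of u False g h "b3 # bs" "c3 # cs"] pos that u w by (simp add: mult.commute)
    have "b1 * c2 = (g * h) * (z * u)" "c1 * b2 = (g * h) * (w * v)"
      by (simp_all add: u w)
    then have cmp: "b1 * c2 < c1 * b2 \<longleftrightarrow> z * u < w * v" "b1 * c2 = c1 * b2 \<longleftrightarrow> z * u = w * v"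
      using gh by simp_all
    have "prec (b1 # b2 # b3 # bs) (c1 # c2 # c3 # cs) \<longleftrightarrow>
        z * u < w * v \<or> u = w \<and> v = z \<and> prec (g # b3 # bs) (h # c3 # cs)"
      using pos unfolding prec.simps red g_def h_def by auto
    also have "\<dots> \<longleftrightarrow> b1 * c2 < c1 * b2 \<or> b1 * c2 = c1 * b2 \<and> lex_cone False b1 c1 (b3 # bs) (c3 # cs)"
      unfolding cmp eq IH using sc by blast
    also have "\<dots> \<longleftrightarrow> cone False (b1 # b2 # b3 # bs) (c1 # c2 # c3 # cs)"
      using False by (simp del: lex_cone.simps(1) add: lex_cone.simps(1)[of False b1 c1 b2])
    finally show ?thesis .
  qed
next
  case (1 b1 b2 c1 c2)
  then show ?case
    by (cases "b1 = 0"; cases "c1 = 0") (simp_all add: mult.commute)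
qed simp_all

lemma lex_cone_mono: "lex_cone False a b xs ys \<Longrightarrow> lex_cone s a b xs ys"
  by (induction xs ys rule: list_induct2') auto

lemma cone_mono: "cone False \<beta> \<gamma> \<Longrightarrow> cone s \<beta> \<gamma>"
  by (induction \<beta> \<gamma> rule: list_induct2') (auto intro: lex_cone_mono split: if_splits)

lemma cone_zero: "length \<beta> = q \<Longrightarrow> cone s \<beta> (vec_zero q) = s"
  using cone_smult[of s \<beta> 0] by (simp only: smult_zero)

text \<open>Repeated addition; the induction starts at 1 because the zero multiple is not in the
  strict cone.\<close>

lemma cone_scale:
  assumes "cone False \<beta> \<gamma>" "length \<beta> = length \<gamma>" "0 < n"
  shows "cone False \<beta> (vec_smult n \<gamma>)"
proof -
  have "cone False \<beta> (vec_smult (Suc m) \<gamma>)" for m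
  proof (induction m)
    case 0
    show ?case
      using assms(1) by (simp add: map_idI)
  next
    case (Suc m)
    have "vec_smult (Suc (Suc m)) \<gamma> = vec_add (vec_smult 1 \<gamma>) (vec_smult (Suc m) \<gamma>)"
      by (simp only: vec_add_smult) simp
    moreover have "cone False \<beta> (vec_add (vec_smult 1 \<gamma>) (vec_smult (Suc m) \<gamma>))"
      using cone_add[of False \<beta> "vec_smult 1 \<gamma>" False "vec_smult (Suc m) \<gamma>"] assms Suc
      by (simp add: map_idI)
    ultimately show ?case
      by (simp only:)
  qed
  then show ?thesis
    using assms(3) by (metis gr0_implies_Suc)
qed

section \<open>HS-derivations acting on power series\<close>

lemma splitsD:
  assumes "(\<beta>, \<gamma>) \<in> splits \<alpha>"
  shows "length \<beta> = length \<alpha>" "length \<gamma> = length \<alpha>" "vec_add \<beta> \<gamma> = \<alpha>"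
    "vec_le \<beta> \<alpha>" "vec_le \<gamma> \<alpha>" "sum_list \<alpha> = sum_list \<beta> + sum_list \<gamma>"
proof -
  show *: "length \<beta> = length \<alpha>" "length \<gamma> = length \<alpha>" "vec_add \<beta> \<gamma> = \<alpha>"
    using assms by (auto simp: splits_def)
  show "vec_le \<beta> \<alpha>"
    using vec_le_add[of \<beta> \<gamma>] * by simp
  show "vec_le \<gamma> \<alpha>"
    using vec_le_add[of \<gamma> \<beta>] vec_add_commute[of \<gamma> \<beta>] * by simp
  show "sum_list \<alpha> = sum_list \<beta> + sum_list \<gamma>"
    using sum_list_vec_add[of \<beta> \<gamma>] * by simp
qed

lemma splits_swap: "(\<beta>, \<gamma>) \<in> splits \<alpha> \<longleftrightarrow> (\<gamma>, \<beta>) \<in> splits \<alpha>"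
  by (auto simp: splits_def vec_add_commute)

lemma zero_splits: "length \<alpha> = n \<Longrightarrow> (vec_zero n, \<alpha>) \<in> splits \<alpha>"
  using vec_add_zero[of \<alpha> n] by (auto simp: splits_def vec_add_commute[of "vec_zero n"])

lemma splits_zero: "length \<alpha> = n \<Longrightarrow> (\<alpha>, vec_zero n) \<in> splits \<alpha>"
  using zero_splits splits_swap by blast

lemma splits_left_zero: "(vec_zero n, \<gamma>) \<in> splits \<alpha> \<Longrightarrow> \<gamma> = \<alpha>"
  using splitsD[of "vec_zero n" \<gamma> \<alpha>] vec_add_zero[of \<gamma> n] vec_add_commute[of "vec_zero n" \<gamma>] by simp

lemma splits_right_zero: "(\<beta>, vec_zero n) \<in> splits \<alpha> \<Longrightarrow> \<beta> = \<alpha>"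
  using splits_left_zero splits_swap by blast

lemma splits_of_zero:
  assumes "(\<beta>, \<gamma>) \<in> splits (vec_zero q)"
  shows "\<beta> = vec_zero q" "\<gamma> = vec_zero q"
  using splitsD(1,2,6)[OF assms] sum_list_pos[of \<beta>] sum_list_pos[of \<gamma>]
  by (auto simp: sum_list_replicate simp del: sum_list_eq_0_iff)

lemma splits_sum_list_less:
  assumes "(\<beta>, \<gamma>) \<in> splits \<alpha>" "\<beta> \<noteq> vec_zero (length \<alpha>)"
  shows "sum_list \<gamma> < sum_list \<alpha>"
  using assms splitsD(1,6)[OF assms(1)] sum_list_pos[of \<beta>] by simp

lemma vec_le_sum_list: "vec_le \<beta> \<alpha> \<Longrightarrow> b \<in> set \<beta> \<Longrightarrow> b \<le> sum_list \<alpha>"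
  by (induction rule: list_all2_induct) auto

lemma finite_vec_le: "finite {\<beta>. vec_le \<beta> \<alpha>}"
proof (rule finite_subset)
  show "{\<beta>. vec_le \<beta> \<alpha>} \<subseteq> {\<beta>. set \<beta> \<subseteq> {..sum_list \<alpha>} \<and> length \<beta> = length \<alpha>}"
    by (auto simp: list_all2_lengthD dest: vec_le_sum_list)
qed (simp add: finite_lists_length_eq)

lemma finite_splits [simp]: "finite (splits \<alpha>)"
proof (rule finite_subset)
  show "splits \<alpha> \<subseteq> {\<beta>. vec_le \<beta> \<alpha>} \<times> {\<beta>. vec_le \<beta> \<alpha>}"
    by (auto dest: splitsD)
qed (simp add: finite_vec_le)

lemma sum_splits_swap: "(\<Sum>(\<beta>, \<gamma>)\<in>splits \<alpha>. f \<beta> \<gamma>) = (\<Sum>(\<beta>, \<gamma>)\<in>splits \<alpha>. f \<gamma> \<beta>)"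
  by (rule sum.reindex_bij_witness[of _ prod.swap prod.swap]) (auto simp: splits_swap)

lemma splits_regroup_right:
  assumes "(\<beta>, \<gamma>) \<in> splits \<alpha>" "(\<delta>, \<epsilon>) \<in> splits \<beta>"
  shows "(\<delta>, vec_add \<epsilon> \<gamma>) \<in> splits \<alpha>" "(\<epsilon>, \<gamma>) \<in> splits (vec_add \<epsilon> \<gamma>)" "vec_add \<delta> \<epsilon> = \<beta>"
proof -
  have len: "length \<delta> = length \<alpha>" "length \<epsilon> = length \<alpha>" "length \<gamma> = length \<alpha>"
    using splitsD(1,2)[OF assms(1)] splitsD(1,2)[OF assms(2)] by simp_all
  have "vec_add \<delta> (vec_add \<epsilon> \<gamma>) = \<alpha>"
    by (simp only: vec_add_assoc[symmetric] splitsD(3)[OF assms(1)] splitsD(3)[OF assms(2)])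
  then show "(\<delta>, vec_add \<epsilon> \<gamma>) \<in> splits \<alpha>" "(\<epsilon>, \<gamma>) \<in> splits (vec_add \<epsilon> \<gamma>)" "vec_add \<delta> \<epsilon> = \<beta>"
    using splitsD(3)[OF assms(2)] by (simp_all add: splits_def len)
qed

lemma splits_regroup_left:
  assumes "(\<delta>, \<zeta>) \<in> splits \<alpha>" "(\<epsilon>, \<gamma>) \<in> splits \<zeta>"
  shows "(vec_add \<delta> \<epsilon>, \<gamma>) \<in> splits \<alpha>" "(\<delta>, \<epsilon>) \<in> splits (vec_add \<delta> \<epsilon>)" "vec_add \<epsilon> \<gamma> = \<zeta>"
proof -
  have len: "length \<delta> = length \<alpha>" "length \<epsilon> = length \<alpha>" "length \<gamma> = length \<alpha>"
    using splitsD(1,2)[OF assms(1)] splitsD(1,2)[OF assms(2)] by simp_all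
  have "vec_add (vec_add \<delta> \<epsilon>) \<gamma> = \<alpha>"
    by (simp only: vec_add_assoc splitsD(3)[OF assms(1)] splitsD(3)[OF assms(2)])
  then show "(vec_add \<delta> \<epsilon>, \<gamma>) \<in> splits \<alpha>" "(\<delta>, \<epsilon>) \<in> splits (vec_add \<delta> \<epsilon>)" "vec_add \<epsilon> \<gamma> = \<zeta>"
    using splitsD(3)[OF assms(2)] by (simp_all add: splits_def len)
qed

lemma sum_splits_assoc:
  "(\<Sum>(\<beta>, \<gamma>)\<in>splits \<alpha>. \<Sum>(\<delta>, \<epsilon>)\<in>splits \<beta>. f \<delta> \<epsilon> \<gamma>) =
   (\<Sum>(\<delta>, \<zeta>)\<in>splits \<alpha>. \<Sum>(\<epsilon>, \<gamma>)\<in>splits \<zeta>. f \<delta> \<epsilon> \<gamma>)"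
proof -
  have "(\<Sum>(\<beta>, \<gamma>)\<in>splits \<alpha>. \<Sum>(\<delta>, \<epsilon>)\<in>splits \<beta>. f \<delta> \<epsilon> \<gamma>) =
      (\<Sum>(p, r)\<in>(SIGMA p:splits \<alpha>. splits (fst p)). f (fst r) (snd r) (snd p))"
    by (subst sum.Sigma[symmetric]) (auto simp: case_prod_unfold)
  also have "\<dots> = (\<Sum>(p, r)\<in>(SIGMA p:splits \<alpha>. splits (snd p)). f (fst p) (fst r) (snd r))"
    by (rule sum.reindex_bij_witness[of _
          "\<lambda>((\<delta>, \<zeta>), (\<epsilon>, \<gamma>)). ((vec_add \<delta> \<epsilon>, \<gamma>), (\<delta>, \<epsilon>))"
          "\<lambda>((\<beta>, \<gamma>), (\<delta>, \<epsilon>)). ((\<delta>, vec_add \<epsilon> \<gamma>), (\<epsilon>, \<gamma>))"])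
      (auto simp: splits_regroup_left splits_regroup_right)
  also have "\<dots> = (\<Sum>(\<delta>, \<zeta>)\<in>splits \<alpha>. \<Sum>(\<epsilon>, \<gamma>)\<in>splits \<zeta>. f \<delta> \<epsilon> \<gamma>)"
    by (subst sum.Sigma[symmetric]) (auto simp: case_prod_unfold)
  finally show ?thesis .
qed

text \<open>Both sides run over all decompositions of \<alpha> into four summands. Associativity
  isolates \<beta>1; among the other three summands, commutativity exchanges the roles of \<beta>2
  and \<gamma>1.\<close>

lemma sum_splits_interchange:
  "(\<Sum>(\<beta>, \<gamma>)\<in>splits \<alpha>. \<Sum>(\<beta>1, \<beta>2)\<in>splits \<beta>. \<Sum>(\<gamma>1, \<gamma>2)\<in>splits \<gamma>. f \<beta>1 \<beta>2 \<gamma>1 \<gamma>2) =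
   (\<Sum>(\<beta>, \<gamma>)\<in>splits \<alpha>. \<Sum>(\<beta>1, \<gamma>1)\<in>splits \<beta>. \<Sum>(\<beta>2, \<gamma>2)\<in>splits \<gamma>. f \<beta>1 \<beta>2 \<gamma>1 \<gamma>2)"
proof -
  have inner: "(\<Sum>(\<beta>2, \<gamma>)\<in>splits \<zeta>. \<Sum>(\<gamma>1, \<gamma>2)\<in>splits \<gamma>. f \<beta>1 \<beta>2 \<gamma>1 \<gamma>2) =
      (\<Sum>(\<gamma>1, \<epsilon>)\<in>splits \<zeta>. \<Sum>(\<beta>2, \<gamma>2)\<in>splits \<epsilon>. f \<beta>1 \<beta>2 \<gamma>1 \<gamma>2)" for \<beta>1 \<zeta>
    by (subst (1 2) sum_splits_assoc[symmetric], subst (2) sum_splits_swap) simp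
  show ?thesis
    by (subst (1 2) sum_splits_assoc) (simp add: inner)
qed

text \<open>
  \<open>series_act D\<close> is the endomorphism of \<open>A[[s]]\<^sub>\<Delta>\<close> induced by \<open>D\<close> on coefficient families. It is
  multiplicative and bijective for an HS-derivation \<open>D\<close>, which replaces the group structure on
  HS-derivations. None of the operations below is cut off at \<open>\<Delta>\<close>: truncation then amounts to
  comparing components on a smaller co-ideal.
\<close>

definition series_act :: "(nat list \<Rightarrow> 'a \<Rightarrow> 'a) \<Rightarrow> (nat list \<Rightarrow> 'a) \<Rightarrow> nat list \<Rightarrow> 'a::comm_monoid_add" where
  "series_act D u \<alpha> = (\<Sum>(\<beta>, \<gamma>)\<in>splits \<alpha>. D \<beta> (u \<gamma>))"

definition series_mult :: "(nat list \<Rightarrow> 'a) \<Rightarrow> (nat list \<Rightarrow> 'a) \<Rightarrow> nat list \<Rightarrow> 'a::{comm_ring, comm_monoid_mult}" where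
  "series_mult u v \<alpha> = (\<Sum>(\<beta>, \<gamma>)\<in>splits \<alpha>. u \<beta> * v \<gamma>)"

definition series_comp :: "(nat list \<Rightarrow> 'a \<Rightarrow> 'a) \<Rightarrow> (nat list \<Rightarrow> 'a \<Rightarrow> 'a) \<Rightarrow> nat list \<Rightarrow> 'a \<Rightarrow> 'a::comm_monoid_add" where
  "series_comp D E \<alpha> x = series_act D (\<lambda>\<gamma>. E \<gamma> x) \<alpha>"

definition series_one :: "nat list \<Rightarrow> 'a \<Rightarrow> 'a::zero" where
  "series_one \<alpha> = (if \<alpha> = vec_zero (length \<alpha>) then id else (\<lambda>x. 0))"

text \<open>Extensionality is left out, so that a single family represents all its truncations and
  passing to a smaller co-ideal is mere weakening.\<close>

definition is_HS :: "('k \<Rightarrow> 'a \<Rightarrow> 'a) \<Rightarrow> nat \<Rightarrow> nat list set \<Rightarrow>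
    (nat list \<Rightarrow> 'a::{comm_ring, comm_monoid_mult} \<Rightarrow> 'a) \<Rightarrow> bool" where
  "is_HS scale q \<Delta> D \<longleftrightarrow> (\<forall>\<alpha>\<in>\<Delta>. klinear scale (D \<alpha>)) \<and> D (vec_zero q) = id \<and>
     (\<forall>\<alpha>\<in>\<Delta>. \<forall>x y. D \<alpha> (x * y) = series_mult (\<lambda>\<beta>. D \<beta> x) (\<lambda>\<gamma>. D \<gamma> y) \<alpha>)"

lemma HS_iff: "D \<in> HS scale q \<Delta> \<longleftrightarrow> D \<in> extensional \<Delta> \<and> is_HS scale q \<Delta> D"
  by (auto simp: HS_def is_HS_def series_mult_def)

lemma is_HS_mono: "is_HS scale q \<Delta> D \<Longrightarrow> \<Delta>' \<subseteq> \<Delta> \<Longrightarrow> is_HS scale q \<Delta>' D"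
  by (auto simp: is_HS_def)

lemma coideal_zero: "coideal q \<Delta> \<Longrightarrow> \<Delta> \<noteq> {} \<Longrightarrow> vec_zero q \<in> \<Delta>"
  unfolding coideal_def by (force simp: list_all2_conv_all_nth)

lemma coideal_length: "coideal q \<Delta> \<Longrightarrow> \<alpha> \<in> \<Delta> \<Longrightarrow> length \<alpha> = q"
  by (auto simp: coideal_def)

lemma coideal_splits:
  "coideal q \<Delta> \<Longrightarrow> \<alpha> \<in> \<Delta> \<Longrightarrow> (\<beta>, \<gamma>) \<in> splits \<alpha> \<Longrightarrow> \<beta> \<in> \<Delta> \<and> \<gamma> \<in> \<Delta>"
  by (auto simp: coideal_def dest: splitsD(4,5))

lemma klinearD:
  assumes "klinear scale f"
  shows "f (x + y) = f x + f y" "f (scale c x) = scale c (f x)" "f 0 = 0" "f (x - y) = f x - f y"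
    "f (sum g S) = (\<Sum>i\<in>S. f (g i))"
proof -
  show add: "f (x + y) = f x + f y" for x y
    using assms by (simp add: klinear_def)
  show "f (scale c x) = scale c (f x)"
    using assms by (simp add: klinear_def)
  show zero: "f 0 = 0"
    using add[of 0 0] by simp
  show "f (x - y) = f x - f y"
    using add[of "x - y" y] by (simp add: algebra_simps)
  show "f (sum g S) = (\<Sum>i\<in>S. f (g i))"
    by (induction S rule: infinite_finite_induct) (simp_all add: add zero)
qed

text \<open>Solves \<open>series_act D u = w\<close> for \<open>u\<close> when the component of
  \<open>D\<close> at 0 is the identity: the splitting with zero first part contributes
  \<open>u \<alpha>\<close> itself, and all other splittings involve values of \<open>u\<close> of
  smaller total degree.\<close>

function series_solve :: "(nat list \<Rightarrow> 'a \<Rightarrow> 'a) \<Rightarrow> (nat list \<Rightarrow> 'a) \<Rightarrow> nat list \<Rightarrow> 'a::ab_group_add" where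
  "series_solve D w \<alpha> = w \<alpha> - (\<Sum>p\<in>{p \<in> splits \<alpha>. fst p \<noteq> vec_zero (length \<alpha>)}. D (fst p) (series_solve D w (snd p)))"
  by auto
termination
  by (relation "measure (\<lambda>(D, w, \<alpha>). sum_list \<alpha>)") (auto intro: splits_sum_list_less)

declare series_solve.simps [simp del]

abbreviation psi :: "nat list \<Rightarrow> (nat list \<Rightarrow> 'a \<Rightarrow> 'a) \<Rightarrow> nat list \<Rightarrow> 'a \<Rightarrow> 'a::comm_monoid_add" where
  "psi \<equiv> psi_act UNIV"

lemma psi_act_eq: "\<alpha> \<in> \<Delta> \<Longrightarrow> psi_act \<Delta> \<beta> E \<alpha> = psi \<beta> E \<alpha>"
  by (simp add: psi_act_def)

text \<open>For primitive \<beta> this is the index set used by \<open>HS1\<close> at length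
  \<open>ray_card \<Delta> \<beta>\<close>, with the cardinality replaced by a membership condition;
  finite and infinite rays need no distinction.\<close>

abbreviation ray_index :: "nat list set \<Rightarrow> nat list \<Rightarrow> nat list set" where
  "ray_index \<Delta> \<beta> \<equiv> {[n] | n. vec_smult n \<beta> \<in> \<Delta>}"

lemma psi_smult: "\<beta> \<in> primitive q \<Longrightarrow> psi \<beta> E (vec_smult n \<beta>) = E [n]"
  by (rule psi_act_component(1)[OF primitiveD(2)]) simp_all

lemma psi_other: "\<beta> \<in> primitive q \<Longrightarrow> \<nexists>n. \<alpha> = vec_smult n \<beta> \<Longrightarrow> psi \<beta> E \<alpha> = (\<lambda>x. 0)"
  by (rule psi_act_component(2)[OF primitiveD(2)]) simp_all

lemma sum_splits_singleton: "(\<Sum>(\<beta>, \<gamma>)\<in>splits [n]. f \<beta> \<gamma>) = (\<Sum>i\<le>n. f [i] [n - i])"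
  by (rule sum.reindex_bij_witness[of _ "\<lambda>i. ([i], [n - i])" "\<lambda>(\<beta>, \<gamma>). hd \<beta>"])
    (auto simp: splits_def length_Suc_conv)

text \<open>Turns the multivariate Leibniz sum at n\<beta> into the one-variate sum at n. The
  splittings that stay on the ray are the pairs of i\<beta> and (n - i)\<beta>, each occurring once
  because n determines n\<beta> injectively.\<close>

lemma sum_splits_smult:
  assumes \<beta>: "\<beta> \<noteq> vec_zero (length \<beta>)"
    and zero: "\<And>\<gamma> \<delta>. (\<gamma>, \<delta>) \<in> splits (vec_smult n \<beta>) \<Longrightarrow>
      \<nexists>i j. \<gamma> = vec_smult i \<beta> \<and> \<delta> = vec_smult j \<beta> \<Longrightarrow> f \<gamma> \<delta> = 0"
  shows "(\<Sum>(\<gamma>, \<delta>)\<in>splits (vec_smult n \<beta>). f \<gamma> \<delta>) =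
    (\<Sum>i\<le>n. f (vec_smult i \<beta>) (vec_smult (n - i) \<beta>))"
proof -
  let ?h = "\<lambda>i. (vec_smult i \<beta>, vec_smult (n - i) \<beta>)"
  have "(\<Sum>(\<gamma>, \<delta>)\<in>splits (vec_smult n \<beta>). f \<gamma> \<delta>) = (\<Sum>(\<gamma>, \<delta>)\<in>?h ` {..n}. f \<gamma> \<delta>)"
  proof (intro sum.mono_neutral_right ballI)
    show "?h ` {..n} \<subseteq> splits (vec_smult n \<beta>)"
      by (auto simp: splits_def vec_add_smult)
    fix p
    assume p: "p \<in> splits (vec_smult n \<beta>) - ?h ` {..n}"
    obtain \<gamma> \<delta> where p_eq: "p = (\<gamma>, \<delta>)"
      by (cases p)
    have "\<nexists>i j. \<gamma> = vec_smult i \<beta> \<and> \<delta> = vec_smult j \<beta>"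
    proof
      assume "\<exists>i j. \<gamma> = vec_smult i \<beta> \<and> \<delta> = vec_smult j \<beta>"
      then obtain i j where ij: "\<gamma> = vec_smult i \<beta>" "\<delta> = vec_smult j \<beta>"
        by blast
      have "vec_add \<gamma> \<delta> = vec_smult n \<beta>"
        using p p_eq splitsD(3) by blast
      then have "vec_smult (i + j) \<beta> = vec_smult n \<beta>"
        by (simp only: ij vec_add_smult)
      then have "n = i + j"
        using injD[OF inj_vec_smult[OF \<beta>]] by metis
      then have "p = ?h i" "i \<le> n"
        using p_eq ij by simp_all
      then show False
        using p by blast
    qed
    then show "(case p of (\<gamma>, \<delta>) \<Rightarrow> f \<gamma> \<delta>) = 0"
      using p p_eq zero by simp
  qed simp
  also have "\<dots> = (\<Sum>i\<le>n. f (vec_smult i \<beta>) (vec_smult (n - i) \<beta>))"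
  proof (subst sum.reindex)
    show "inj_on ?h {..n}"
      using inj_vec_smult[OF \<beta>] by (auto simp: inj_on_def simp del: map_eq_conv)
  qed simp
  finally show ?thesis .
qed

text \<open>The head of the list is the leftmost factor, as in \<open>ordered_comp\<close>; on an
  increasing list the smallest ray can thus be removed by left division.\<close>

definition ray_product :: "nat list list \<Rightarrow> (nat list \<Rightarrow> nat list \<Rightarrow> 'a \<Rightarrow> 'a) \<Rightarrow>
    nat list \<Rightarrow> 'a \<Rightarrow> 'a::comm_monoid_add" where
  "ray_product xs R = foldr (\<lambda>i. series_comp (R i)) xs series_one"

lemma ray_product_simps [simp]:
  "ray_product [] R = series_one"
  "ray_product (x # xs) R = series_comp (R x) (ray_product xs R)"
  by (simp_all add: ray_product_def)

section \<open>HS-derivations on a fixed co-ideal: composition and left division\<close>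

locale coideal_algebra = comm_algebra scale
  for scale :: "'k::{comm_ring, comm_monoid_mult} \<Rightarrow> 'a::{comm_ring, comm_monoid_mult} \<Rightarrow> 'a" +
  fixes q :: nat and \<Delta> :: "nat list set"
  assumes coideal: "coideal q \<Delta>" and nonempty: "\<Delta> \<noteq> {}"
begin

lemmas in_splits = coideal_splits[OF coideal]
lemmas length_eq = coideal_length[OF coideal]
lemmas zero_in = coideal_zero[OF coideal nonempty]

abbreviation isHS where "isHS \<equiv> is_HS scale q \<Delta>"

lemma scale_zero: "scale c 0 = 0"
  using scale_add_right[of c 0 0] by simp

lemma scale_sum: "scale c (sum g S) = (\<Sum>i\<in>S. scale c (g i))"
  by (induction S rule: infinite_finite_induct) (simp_all add: scale_add_right scale_zero)

lemma isHS_klinear: "isHS D \<Longrightarrow> \<alpha> \<in> \<Delta> \<Longrightarrow> klinear scale (D \<alpha>)"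
  by (simp add: is_HS_def)

lemma isHS_zero: "isHS D \<Longrightarrow> D (vec_zero q) = id"
  by (simp add: is_HS_def)

lemma isHS_mult:
  "isHS D \<Longrightarrow> \<alpha> \<in> \<Delta> \<Longrightarrow> D \<alpha> (x * y) = series_mult (\<lambda>\<beta>. D \<beta> x) (\<lambda>\<gamma>. D \<gamma> y) \<alpha>"
  by (simp add: is_HS_def)

lemma sum_splits_cong:
  assumes "\<alpha> \<in> \<Delta>" "\<And>\<beta> \<gamma>. \<beta> \<in> \<Delta> \<Longrightarrow> \<gamma> \<in> \<Delta> \<Longrightarrow> f \<beta> \<gamma> = g \<beta> \<gamma>"
  shows "(\<Sum>(\<beta>, \<gamma>)\<in>splits \<alpha>. f \<beta> \<gamma>) = (\<Sum>(\<beta>, \<gamma>)\<in>splits \<alpha>. g \<beta> \<gamma>)"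
proof (rule sum.cong, simp, clarify)
  fix \<beta> \<gamma>
  assume "(\<beta>, \<gamma>) \<in> splits \<alpha>"
  then show "f \<beta> \<gamma> = g \<beta> \<gamma>"
    using assms in_splits by blast
qed

lemma isHS_cong:
  assumes D: "isHS D" and eq: "\<And>\<alpha>. \<alpha> \<in> \<Delta> \<Longrightarrow> D \<alpha> = E \<alpha>"
  shows "isHS E"
proof -
  have "series_mult (\<lambda>\<beta>. E \<beta> x) (\<lambda>\<gamma>. E \<gamma> y) \<alpha> = series_mult (\<lambda>\<beta>. D \<beta> x) (\<lambda>\<gamma>. D \<gamma> y) \<alpha>" if "\<alpha> \<in> \<Delta>" for x y \<alpha>
    unfolding series_mult_def by (rule sum_splits_cong[OF that]) (simp add: eq)
  then show ?thesis
    using D eq[OF zero_in] eq by (simp add: is_HS_def)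
qed

lemma series_act_cong:
  assumes "\<alpha> \<in> \<Delta>" "\<And>\<beta>. \<beta> \<in> \<Delta> \<Longrightarrow> D \<beta> = D' \<beta>" "\<And>\<beta>. \<beta> \<in> \<Delta> \<Longrightarrow> u \<beta> = v \<beta>"
  shows "series_act D u \<alpha> = series_act D' v \<alpha>"
  unfolding series_act_def by (rule sum_splits_cong[OF assms(1)]) (simp add: assms)

lemma series_comp_cong:
  assumes "\<alpha> \<in> \<Delta>" "\<And>\<beta>. \<beta> \<in> \<Delta> \<Longrightarrow> D \<beta> = D' \<beta>" "\<And>\<beta>. \<beta> \<in> \<Delta> \<Longrightarrow> E \<beta> = E' \<beta>"
  shows "series_comp D E \<alpha> = series_comp D' E' \<alpha>"
proof
  show "series_comp D E \<alpha> x = series_comp D' E' \<alpha> x" for x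
    unfolding series_comp_def by (rule series_act_cong[OF assms(1)]) (simp_all add: assms)
qed

lemma series_act_single:
  assumes "(\<beta>0, \<gamma>0) \<in> splits \<alpha>"
    and "\<And>\<beta> \<gamma>. (\<beta>, \<gamma>) \<in> splits \<alpha> \<Longrightarrow> (\<beta>, \<gamma>) \<noteq> (\<beta>0, \<gamma>0) \<Longrightarrow> D \<beta> (u \<gamma>) = 0"
  shows "series_act D u \<alpha> = D \<beta>0 (u \<gamma>0)"
proof -
  have "series_act D u \<alpha> = (\<Sum>(\<beta>, \<gamma>)\<in>{(\<beta>0, \<gamma>0)}. D \<beta> (u \<gamma>))"
    unfolding series_act_def using assms by (intro sum.mono_neutral_right) auto
  then show ?thesis
    by simp
qed

lemma series_act_add:
  assumes "isHS D" "\<alpha> \<in> \<Delta>"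
  shows "series_act D (\<lambda>\<gamma>. u \<gamma> + v \<gamma>) \<alpha> = series_act D u \<alpha> + series_act D v \<alpha>"
proof -
  have "series_act D (\<lambda>\<gamma>. u \<gamma> + v \<gamma>) \<alpha> = (\<Sum>(\<beta>, \<gamma>)\<in>splits \<alpha>. D \<beta> (u \<gamma>) + D \<beta> (v \<gamma>))"
    unfolding series_act_def
    by (rule sum_splits_cong[OF assms(2)]) (simp add: klinearD(1)[OF isHS_klinear[OF assms(1)]])
  then show ?thesis
    by (simp add: series_act_def case_prod_unfold sum.distrib)
qed

lemma series_act_scale:
  assumes "isHS D" "\<alpha> \<in> \<Delta>"
  shows "series_act D (\<lambda>\<gamma>. scale c (u \<gamma>)) \<alpha> = scale c (series_act D u \<alpha>)"
proof -
  have "series_act D (\<lambda>\<gamma>. scale c (u \<gamma>)) \<alpha> = (\<Sum>(\<beta>, \<gamma>)\<in>splits \<alpha>. scale c (D \<beta> (u \<gamma>)))"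
    unfolding series_act_def
    by (rule sum_splits_cong[OF assms(2)]) (simp add: klinearD(2)[OF isHS_klinear[OF assms(1)]])
  then show ?thesis
    by (simp add: series_act_def case_prod_unfold scale_sum)
qed

text \<open>Expanding every \<open>D \<beta>\<close> of a product by the Leibniz rule gives a sum
  over four indices. The product of the two transformed series is the same sum with the middle
  indices exchanged.\<close>

lemma series_act_mult:
  assumes "isHS D" "\<alpha> \<in> \<Delta>"
  shows "series_act D (series_mult u v) \<alpha> = series_mult (series_act D u) (series_act D v) \<alpha>"
proof -
  have "series_act D (series_mult u v) \<alpha> = (\<Sum>(\<beta>, \<gamma>)\<in>splits \<alpha>. \<Sum>(\<gamma>1, \<gamma>2)\<in>splits \<gamma>. \<Sum>(\<beta>1, \<beta>2)\<in>splits \<beta>.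
      D \<beta>1 (u \<gamma>1) * D \<beta>2 (v \<gamma>2))"
    unfolding series_act_def
  proof (rule sum.cong, simp, clarify)
    fix \<beta> \<gamma>
    assume "(\<beta>, \<gamma>) \<in> splits \<alpha>"
    then have "\<beta> \<in> \<Delta>"
      using assms(2) in_splits by blast
    then show "D \<beta> (series_mult u v \<gamma>) = (\<Sum>(\<gamma>1, \<gamma>2)\<in>splits \<gamma>. \<Sum>(\<beta>1, \<beta>2)\<in>splits \<beta>.
      D \<beta>1 (u \<gamma>1) * D \<beta>2 (v \<gamma>2))"
      using isHS_mult[OF assms(1)]
      by (simp add: series_mult_def klinearD(5)[OF isHS_klinear[OF assms(1)]] case_prod_unfold)
  qed
  also have "\<dots> = (\<Sum>(\<beta>, \<gamma>)\<in>splits \<alpha>. \<Sum>(\<beta>1, \<beta>2)\<in>splits \<beta>. \<Sum>(\<gamma>1, \<gamma>2)\<in>splits \<gamma>.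
      D \<beta>1 (u \<gamma>1) * D \<beta>2 (v \<gamma>2))"
    by (simp add: case_prod_unfold sum.swap[of _ "splits (fst _)"])
  also have "\<dots> = (\<Sum>(\<beta>, \<gamma>)\<in>splits \<alpha>. \<Sum>(\<beta>1, \<gamma>1)\<in>splits \<beta>. \<Sum>(\<beta>2, \<gamma>2)\<in>splits \<gamma>.
      D \<beta>1 (u \<gamma>1) * D \<beta>2 (v \<gamma>2))"
    by (rule sum_splits_interchange)
  also have "\<dots> = series_mult (series_act D u) (series_act D v) \<alpha>"
    by (simp add: series_mult_def series_act_def case_prod_unfold sum_product)
  finally show ?thesis .
qed

text \<open>The component of \<open>D\<close> at 0 is the identity, so
  \<open>series_act D u \<alpha>\<close> is \<open>u \<alpha>\<close> plus terms in values of
  \<open>u\<close> of smaller total degree: the system is unitriangular.\<close>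

lemma series_act_cancel:
  assumes D: "isHS D" and eq: "\<And>\<alpha>. \<alpha> \<in> \<Delta> \<Longrightarrow> series_act D u \<alpha> = series_act D v \<alpha>" and "\<alpha> \<in> \<Delta>"
  shows "u \<alpha> = v \<alpha>"
  using \<open>\<alpha> \<in> \<Delta>\<close>
proof (induction "sum_list \<alpha>" arbitrary: \<alpha> rule: less_induct)
  case less
  let ?R = "\<lambda>u. \<Sum>(\<beta>, \<gamma>)\<in>splits \<alpha> - {(vec_zero q, \<alpha>)}. D \<beta> (u \<gamma>)"
  have split: "series_act D u \<alpha> = u \<alpha> + ?R u" for u
    unfolding series_act_def using zero_splits[OF length_eq[OF less.prems]] isHS_zero[OF D]
    by (subst sum.remove[of _ "(vec_zero q, \<alpha>)"]) auto
  have "?R u = ?R v"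
  proof (rule sum.cong[OF refl])
    fix p
    assume p: "p \<in> splits \<alpha> - {(vec_zero q, \<alpha>)}"
    obtain \<beta> \<gamma> where p_eq: "p = (\<beta>, \<gamma>)"
      by (cases p)
    then have \<beta>\<gamma>: "(\<beta>, \<gamma>) \<in> splits \<alpha>" "(\<beta>, \<gamma>) \<noteq> (vec_zero q, \<alpha>)"
      using p by simp_all
    then have "\<beta> \<noteq> vec_zero q"
      using splits_left_zero by blast
    then have "sum_list \<gamma> < sum_list \<alpha>"
      using splits_sum_list_less[OF \<beta>\<gamma>(1)] length_eq[OF less.prems] by simp
    then have "u \<gamma> = v \<gamma>"
      using less.hyps in_splits[OF less.prems \<beta>\<gamma>(1)] by blast
    then show "(case p of (\<beta>, \<gamma>) \<Rightarrow> D \<beta> (u \<gamma>)) = (case p of (\<beta>, \<gamma>) \<Rightarrow> D \<beta> (v \<gamma>))"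
      by (simp add: p_eq)
  qed
  then show ?case
    using eq[OF less.prems] split by simp
qed

lemma series_comp_cancel:
  assumes "isHS D" "\<And>\<alpha>. \<alpha> \<in> \<Delta> \<Longrightarrow> series_comp D E \<alpha> = series_comp D F \<alpha>" "\<alpha> \<in> \<Delta>"
  shows "E \<alpha> = F \<alpha>"
proof
  fix x
  show "E \<alpha> x = F \<alpha> x"
    by (rule series_act_cancel[OF assms(1) _ assms(3)]) (metis assms(2) series_comp_def)
qed

lemma series_comp_zero: "series_comp D E (vec_zero q) x = D (vec_zero q) (E (vec_zero q) x)"
  unfolding series_comp_def
proof (rule series_act_single)
  fix \<beta> \<gamma>
  assume "(\<beta>, \<gamma>) \<in> splits (vec_zero q)" "(\<beta>, \<gamma>) \<noteq> (vec_zero q, vec_zero q)"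
  then show "D \<beta> (E \<gamma> x) = 0"
    using splits_of_zero by blast
qed (simp add: zero_splits)

text \<open>The Leibniz rule for \<open>E\<close> says that the series of components of
  \<open>E\<close> at \<open>x * y\<close> is the product of the series at \<open>x\<close> and at
  \<open>y\<close>. Since \<open>series_act D\<close> respects sums, scalars and products of series,
  the composition inherits all the identities.\<close>

lemma isHS_comp:
  assumes D: "isHS D" and E: "isHS E"
  shows "isHS (series_comp D E)"
  unfolding is_HS_def
proof (intro conjI ballI allI)
  have E_cong: "series_comp D E \<alpha> x = series_act D u \<alpha>" if "\<alpha> \<in> \<Delta>" "\<And>\<gamma>. \<gamma> \<in> \<Delta> \<Longrightarrow> E \<gamma> x = u \<gamma>" for \<alpha> x u
    unfolding series_comp_def using that by (auto intro!: series_act_cong)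
  fix \<alpha>
  assume \<alpha>: "\<alpha> \<in> \<Delta>"
  show "klinear scale (series_comp D E \<alpha>)"
    unfolding klinear_def
  proof (intro conjI allI)
    fix x y c
    show "series_comp D E \<alpha> (x + y) = series_comp D E \<alpha> x + series_comp D E \<alpha> y"
      using E_cong[OF \<alpha>, of "x + y"] klinearD(1)[OF isHS_klinear[OF E]] series_act_add[OF D \<alpha>]
      by (simp add: series_comp_def)
    show "series_comp D E \<alpha> (scale c x) = scale c (series_comp D E \<alpha> x)"
      using E_cong[OF \<alpha>, of "scale c x"] klinearD(2)[OF isHS_klinear[OF E]] series_act_scale[OF D \<alpha>]
      by (simp add: series_comp_def)
  qed
  fix x y
  show "series_comp D E \<alpha> (x * y) = series_mult (\<lambda>\<beta>. series_comp D E \<beta> x) (\<lambda>\<gamma>. series_comp D E \<gamma> y) \<alpha>"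
    using E_cong[OF \<alpha>, of "x * y"] isHS_mult[OF E] series_act_mult[OF D \<alpha>]
    by (simp add: series_comp_def[abs_def])
next
  show "series_comp D E (vec_zero q) = id"
  proof
    fix x
    show "series_comp D E (vec_zero q) x = id x"
      using D E by (simp add: isHS_zero series_comp_zero)
  qed
qed

text \<open>The converse direction of the same argument: \<open>series_act D\<close> is injective on
  \<Delta>, so each identity required of \<open>E\<close> may be checked after applying it, where it
  becomes an identity of the composition.\<close>

lemma isHS_left_divide:
  assumes D: "isHS D" and DE: "isHS (series_comp D E)"
  shows "isHS E"
  unfolding is_HS_def
proof (intro conjI ballI allI)
  have lift: "E \<alpha> x = u \<alpha>" if "\<alpha> \<in> \<Delta>" "\<And>\<gamma>. \<gamma> \<in> \<Delta> \<Longrightarrow> series_comp D E \<gamma> x = series_act D u \<gamma>" for \<alpha> x u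
    using series_act_cancel[OF D, of "\<lambda>\<gamma>. E \<gamma> x" u] that by (simp add: series_comp_def)
  fix \<alpha>
  assume \<alpha>: "\<alpha> \<in> \<Delta>"
  show "klinear scale (E \<alpha>)"
    unfolding klinear_def
  proof (intro conjI allI)
    fix x y c
    show "E \<alpha> (x + y) = E \<alpha> x + E \<alpha> y"
    proof (rule lift[OF \<alpha>])
      fix \<gamma>
      assume "\<gamma> \<in> \<Delta>"
      then show "series_comp D E \<gamma> (x + y) = series_act D (\<lambda>\<gamma>. E \<gamma> x + E \<gamma> y) \<gamma>"
        using klinearD(1)[OF isHS_klinear[OF DE], of \<gamma> x y] series_act_add[OF D]
        by (simp add: series_comp_def)
    qed
    show "E \<alpha> (scale c x) = scale c (E \<alpha> x)"
    proof (rule lift[OF \<alpha>])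
      fix \<gamma>
      assume "\<gamma> \<in> \<Delta>"
      then show "series_comp D E \<gamma> (scale c x) = series_act D (\<lambda>\<gamma>. scale c (E \<gamma> x)) \<gamma>"
        using klinearD(2)[OF isHS_klinear[OF DE], of \<gamma> c x] series_act_scale[OF D]
        by (simp add: series_comp_def)
    qed
  qed
  fix x y
  show "E \<alpha> (x * y) = series_mult (\<lambda>\<beta>. E \<beta> x) (\<lambda>\<gamma>. E \<gamma> y) \<alpha>"
  proof (rule lift[OF \<alpha>])
    fix \<gamma>
    assume "\<gamma> \<in> \<Delta>"
    then show "series_comp D E \<gamma> (x * y) = series_act D (series_mult (\<lambda>\<beta>. E \<beta> x) (\<lambda>\<gamma>. E \<gamma> y)) \<gamma>"
      using isHS_mult[OF DE, of \<gamma> x y] series_act_mult[OF D, of \<gamma>]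
      by (simp add: series_comp_def[abs_def])
  qed
next
  show "E (vec_zero q) = id"
  proof
    fix x
    show "E (vec_zero q) x = id x"
      using isHS_zero[OF D] fun_cong[OF isHS_zero[OF DE], of x] by (simp add: series_comp_zero)
  qed
qed

lemma series_act_solve:
  assumes D: "isHS D" and \<alpha>: "\<alpha> \<in> \<Delta>"
  shows "series_act D (series_solve D w) \<alpha> = w \<alpha>"
proof -
  have len: "length \<alpha> = q"
    by (rule length_eq[OF \<alpha>])
  have set: "{p \<in> splits \<alpha>. fst p \<noteq> vec_zero (length \<alpha>)} = splits \<alpha> - {(vec_zero q, \<alpha>)}"
    using splits_left_zero len by fastforce
  have "series_act D (series_solve D w) \<alpha> =
      series_solve D w \<alpha> + (\<Sum>p\<in>splits \<alpha> - {(vec_zero q, \<alpha>)}. D (fst p) (series_solve D w (snd p)))"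
    unfolding series_act_def using zero_splits[OF len] isHS_zero[OF D]
    by (subst sum.remove[of _ "(vec_zero q, \<alpha>)"]) (auto simp: case_prod_unfold)
  then show ?thesis
    using series_solve.simps[of D w \<alpha>] by (simp add: set)
qed

lemma isHS_one: "isHS series_one"
  unfolding is_HS_def
proof (intro conjI ballI allI)
  fix \<alpha>
  assume \<alpha>: "\<alpha> \<in> \<Delta>"
  show "klinear scale (series_one \<alpha>)"
    by (simp add: klinear_def series_one_def scale_zero)
  fix x y
  have "series_mult (\<lambda>\<beta>. series_one \<beta> x) (\<lambda>\<gamma>. series_one \<gamma> y) \<alpha> =
      (\<Sum>(\<beta>, \<gamma>)\<in>{(vec_zero q, \<alpha>)}. series_one \<beta> x * series_one \<gamma> y)"
    unfolding series_mult_def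
  proof (intro sum.mono_neutral_right ballI)
    fix p
    assume p: "p \<in> splits \<alpha> - {(vec_zero q, \<alpha>)}"
    obtain \<beta> \<gamma> where "p = (\<beta>, \<gamma>)"
      by (cases p)
    then show "(case p of (\<beta>, \<gamma>) \<Rightarrow> series_one \<beta> x * series_one \<gamma> y) = 0"
      using p splits_left_zero[of q \<gamma> \<alpha>] splitsD(1)[of \<beta> \<gamma> \<alpha>] length_eq[OF \<alpha>]
      by (auto simp: series_one_def)
  qed (simp_all add: zero_splits length_eq[OF \<alpha>])
  then show "series_one \<alpha> (x * y) = series_mult (\<lambda>\<beta>. series_one \<beta> x) (\<lambda>\<gamma>. series_one \<gamma> y) \<alpha>"
    by (simp add: series_one_def)
qed (simp add: series_one_def)

lemma series_comp_one:
  assumes "\<alpha> \<in> \<Delta>"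
  shows "series_comp series_one E \<alpha> = E \<alpha>"
proof
  fix x
  have "series_comp series_one E \<alpha> x = series_one (vec_zero q) (E \<alpha> x)"
    unfolding series_comp_def
  proof (rule series_act_single)
    fix \<beta> \<gamma>
    assume *: "(\<beta>, \<gamma>) \<in> splits \<alpha>" "(\<beta>, \<gamma>) \<noteq> (vec_zero q, \<alpha>)"
    then have "\<beta> \<noteq> vec_zero q" "length \<beta> = q"
      using splits_left_zero splitsD(1) length_eq[OF assms] by blast+
    then show "series_one \<beta> (E \<gamma> x) = 0"
      by (simp add: series_one_def)
  qed (simp add: zero_splits length_eq[OF assms])
  then show "series_comp series_one E \<alpha> x = E \<alpha> x"
    by (simp add: series_one_def)
qed

section \<open>One-variate derivations along a single ray\<close>

lemma isHS_psi:
  assumes \<beta>: "\<beta> \<in> primitive q" and E: "is_HS scale 1 (ray_index \<Delta> \<beta>) E"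
  shows "isHS (psi \<beta> E)"
  unfolding is_HS_def
proof (intro conjI ballI allI)
  have cases: "(\<exists>n. \<alpha> = vec_smult n \<beta> \<and> [n] \<in> ray_index \<Delta> \<beta>) \<or> (\<nexists>n. \<alpha> = vec_smult n \<beta>)" if "\<alpha> \<in> \<Delta>" for \<alpha>
    using that by auto
  fix \<alpha>
  assume \<alpha>: "\<alpha> \<in> \<Delta>"
  show "klinear scale (psi \<beta> E \<alpha>)"
    using cases[OF \<alpha>]
  proof
    assume "\<exists>n. \<alpha> = vec_smult n \<beta> \<and> [n] \<in> ray_index \<Delta> \<beta>"
    then obtain n where "\<alpha> = vec_smult n \<beta>" "[n] \<in> ray_index \<Delta> \<beta>"
      by blast
    then show ?thesis
      using E by (simp only: psi_smult[OF \<beta>]) (simp add: is_HS_def)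
  qed (simp add: psi_other[OF \<beta>] klinear_def scale_zero)
  fix x y
  have zero: "psi \<beta> E \<gamma> x * psi \<beta> E \<delta> y = 0" if "\<nexists>i j. \<gamma> = vec_smult i \<beta> \<and> \<delta> = vec_smult j \<beta>" for \<gamma> \<delta>
    using that psi_other[OF \<beta>] by (metis mult_zero_left mult_zero_right)
  show "psi \<beta> E \<alpha> (x * y) = series_mult (\<lambda>\<gamma>. psi \<beta> E \<gamma> x) (\<lambda>\<delta>. psi \<beta> E \<delta> y) \<alpha>"
    using cases[OF \<alpha>]
  proof
    assume "\<exists>n. \<alpha> = vec_smult n \<beta> \<and> [n] \<in> ray_index \<Delta> \<beta>"
    then obtain n where n: "\<alpha> = vec_smult n \<beta>" "[n] \<in> ray_index \<Delta> \<beta>"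
      by blast
    have "E [n] (x * y) = series_mult (\<lambda>\<gamma>. E \<gamma> x) (\<lambda>\<delta>. E \<delta> y) [n]"
      using E n(2) unfolding is_HS_def by blast
    then have "psi \<beta> E \<alpha> (x * y) = (\<Sum>i\<le>n. E [i] x * E [n - i] y)"
      unfolding n(1) psi_smult[OF \<beta>] by (simp add: series_mult_def sum_splits_singleton)
    also have "\<dots> = (\<Sum>i\<le>n. psi \<beta> E (vec_smult i \<beta>) x * psi \<beta> E (vec_smult (n - i) \<beta>) y)"
      by (simp only: psi_smult[OF \<beta>])
    also have "\<dots> = series_mult (\<lambda>\<gamma>. psi \<beta> E \<gamma> x) (\<lambda>\<delta>. psi \<beta> E \<delta> y) \<alpha>"
      unfolding series_mult_def n(1)
      by (rule sum_splits_smult[OF primitiveD(2)[OF \<beta>], symmetric]) (rule zero)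
    finally show ?thesis .
  next
    assume no: "\<nexists>n. \<alpha> = vec_smult n \<beta>"
    have "series_mult (\<lambda>\<gamma>. psi \<beta> E \<gamma> x) (\<lambda>\<delta>. psi \<beta> E \<delta> y) \<alpha> = 0"
      unfolding series_mult_def
    proof (intro sum.neutral ballI)
      fix p
      assume p: "p \<in> splits \<alpha>"
      obtain \<gamma> \<delta> where p_eq: "p = (\<gamma>, \<delta>)"
        by (cases p)
      \<comment> \<open>Two multiples of \<beta> would add up to a multiple of \<beta>, so off the
        ray every product in the Leibniz sum has a vanishing factor.\<close>
      have "\<nexists>i j. \<gamma> = vec_smult i \<beta> \<and> \<delta> = vec_smult j \<beta>"
        using no splitsD(3)[of \<gamma> \<delta> \<alpha>] p p_eq vec_add_smult by metis
      then show "(case p of (\<gamma>, \<delta>) \<Rightarrow> psi \<beta> E \<gamma> x * psi \<beta> E \<delta> y) = 0"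
        using zero p_eq by simp
    qed
    then show ?thesis
      by (simp add: psi_other[OF \<beta> no])
  qed
next
  have "[0] \<in> ray_index \<Delta> \<beta>"
    using zero_in smult_zero[OF primitiveD(1)[OF \<beta>]] by simp
  then show "psi \<beta> E (vec_zero q) = id"
    using E psi_smult[OF \<beta>, of E 0] smult_zero[OF primitiveD(1)[OF \<beta>]] by (simp add: is_HS_def)
qed

text \<open>This is where the geometry of the cones enters. If both parts of a splitting of n\<beta>
  lie in the weak cone of \<beta>, they lie on the ray itself. The Leibniz rule of \<open>R\<close>
  at n\<beta> therefore involves only components on the ray.\<close>

lemma isHS_restrict_ray:
  assumes \<beta>: "\<beta> \<in> primitive q" and R: "isHS R"
    and supp: "\<And>\<gamma>. \<gamma> \<in> \<Delta> \<Longrightarrow> \<not> cone True \<beta> \<gamma> \<Longrightarrow> R \<gamma> = (\<lambda>x. 0)"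
  shows "is_HS scale 1 (ray_index \<Delta> \<beta>) (\<lambda>a. R (vec_smult (hd a) \<beta>))"
  unfolding is_HS_def
proof (intro conjI ballI allI)
  fix a
  assume "a \<in> ray_index \<Delta> \<beta>"
  then obtain n where n: "a = [n]" "vec_smult n \<beta> \<in> \<Delta>"
    by blast
  show "klinear scale (R (vec_smult (hd a) \<beta>))"
    using n isHS_klinear[OF R] by simp
  fix x y
  have zero: "R \<gamma> x * R \<delta> y = 0"
    if *: "(\<gamma>, \<delta>) \<in> splits (vec_smult n \<beta>)" "\<nexists>i j. \<gamma> = vec_smult i \<beta> \<and> \<delta> = vec_smult j \<beta>" for \<gamma> \<delta>
  proof (rule ccontr)
    assume "R \<gamma> x * R \<delta> y \<noteq> 0"
    then have nz: "R \<gamma> \<noteq> (\<lambda>x. 0)" "R \<delta> \<noteq> (\<lambda>x. 0)"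
      by auto
    have in\<Delta>: "\<gamma> \<in> \<Delta>" "\<delta> \<in> \<Delta>"
      using in_splits[OF n(2) *(1)] by simp_all
    then have c: "cone True \<beta> \<gamma>" "cone True \<beta> \<delta>"
      using supp nz by blast+
    have len: "length \<beta> = length \<gamma>" "length \<gamma> = length \<delta>" "length \<gamma> = q" "length \<delta> = q"
      using primitiveD(1)[OF \<beta>] length_eq in\<Delta> by simp_all
    \<comment> \<open>A part off the ray is strictly above \<beta>, which would make the sum
      n\<beta> strictly above \<beta> as well.\<close>
    have "cone False \<beta> \<gamma> \<or> cone False \<beta> \<delta>"
      using cone_True_cases[OF \<beta> _ c(1)] cone_True_cases[OF \<beta> _ c(2)] len *(2) by blast
    then have "cone False \<beta> (vec_add \<gamma> \<delta>)"
      using cone_add[OF _ c(2) len(1,2), of False] cone_add[OF c(1) _ len(1,2), of False] by auto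
    then show False
      using splitsD(3)[OF *(1)] by simp
  qed
  show "R (vec_smult (hd a) \<beta>) (x * y) =
      series_mult (\<lambda>b. R (vec_smult (hd b) \<beta>) x) (\<lambda>c. R (vec_smult (hd c) \<beta>) y) a"
  proof -
    have "R (vec_smult n \<beta>) (x * y) = (\<Sum>i\<le>n. R (vec_smult i \<beta>) x * R (vec_smult (n - i) \<beta>) y)"
      unfolding isHS_mult[OF R n(2)] series_mult_def
      by (rule sum_splits_smult[OF primitiveD(2)[OF \<beta>]]) (rule zero)
    then show ?thesis
      by (simp add: n(1) series_mult_def sum_splits_singleton)
  qed
next
  show "R (vec_smult (hd (vec_zero 1)) \<beta>) = id"
    using isHS_zero[OF R] smult_zero[OF primitiveD(1)[OF \<beta>]] by simp
qed

text \<open>Adding a multiple of \<beta> to a vector strictly above \<beta> never leads back to the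
  ray. So only the splitting of n\<beta> with second part 0 contributes, and the left factor can be
  read off from the composition.\<close>

lemma series_comp_psi_smult:
  assumes \<beta>: "\<beta> \<in> primitive q" and E: "isHS (psi \<beta> E)" and F: "isHS F"
    and supp: "\<And>\<gamma>. \<gamma> \<in> \<Delta> \<Longrightarrow> \<gamma> \<noteq> vec_zero q \<Longrightarrow> \<not> cone False \<beta> \<gamma> \<Longrightarrow> F \<gamma> = (\<lambda>x. 0)"
    and n: "vec_smult n \<beta> \<in> \<Delta>"
  shows "series_comp (psi \<beta> E) F (vec_smult n \<beta>) = E [n]"
proof
  fix x
  note len\<beta> = primitiveD(1)[OF \<beta>]
  have "series_comp (psi \<beta> E) F (vec_smult n \<beta>) x = psi \<beta> E (vec_smult n \<beta>) (F (vec_zero q) x)"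
    unfolding series_comp_def
  proof (rule series_act_single)
    show "(vec_smult n \<beta>, vec_zero q) \<in> splits (vec_smult n \<beta>)"
      by (simp add: splits_zero len\<beta>)
    fix \<gamma> \<delta>
    assume *: "(\<gamma>, \<delta>) \<in> splits (vec_smult n \<beta>)" "(\<gamma>, \<delta>) \<noteq> (vec_smult n \<beta>, vec_zero q)"
    have \<delta>: "\<delta> \<noteq> vec_zero q"
      using * splits_right_zero by blast
    have in\<Delta>: "\<gamma> \<in> \<Delta>" "\<delta> \<in> \<Delta>"
      using in_splits[OF n *(1)] by simp_all
    show "psi \<beta> E \<gamma> (F \<delta> x) = 0"
    proof (cases "\<exists>i. \<gamma> = vec_smult i \<beta>")
      case True
      then obtain i where i: "\<gamma> = vec_smult i \<beta>" ..
      have "\<not> cone False \<beta> \<delta>"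
      proof
        assume "cone False \<beta> \<delta>"
        then have "cone False \<beta> (vec_add \<gamma> \<delta>)"
          using cone_add[of True \<beta> \<gamma> False \<delta>] i len\<beta> length_eq[OF in\<Delta>(2)] by simp
        then show False
          using splitsD(3)[OF *(1)] by simp
      qed
      then show ?thesis
        using supp[OF in\<Delta>(2) \<delta>] klinearD(3)[OF isHS_klinear[OF E in\<Delta>(1)]] by simp
    qed (simp add: psi_other[OF \<beta>])
  qed
  then show "series_comp (psi \<beta> E) F (vec_smult n \<beta>) x = E [n] x"
    by (simp only: psi_smult[OF \<beta>] isHS_zero[OF F] id_apply)
qed

text \<open>\<open>E\<close> copies \<open>R\<close> along the ray and \<open>F\<close> is the left
  quotient. That \<open>F\<close> vanishes outside the strict cone follows by induction on the total
  degree: at such a \<gamma> all splittings into two nonzero parts contribute nothing, which leaves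
  an equation between \<open>R\<close>, \<open>F\<close> and the ray factor at \<gamma>
  alone.\<close>

lemma peel_smallest_ray:
  assumes \<beta>: "\<beta> \<in> primitive q" and R: "isHS R"
    and supp: "\<And>\<gamma>. \<gamma> \<in> \<Delta> \<Longrightarrow> \<not> cone True \<beta> \<gamma> \<Longrightarrow> R \<gamma> = (\<lambda>x. 0)"
  obtains E F where "is_HS scale 1 (ray_index \<Delta> \<beta>) E" "isHS F"
    and "\<And>\<alpha>. \<alpha> \<in> \<Delta> \<Longrightarrow> series_comp (psi \<beta> E) F \<alpha> = R \<alpha>"
    and "\<And>\<gamma>. \<gamma> \<in> \<Delta> \<Longrightarrow> \<gamma> \<noteq> vec_zero q \<Longrightarrow> \<not> cone False \<beta> \<gamma> \<Longrightarrow> F \<gamma> = (\<lambda>x. 0)"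
proof -
  note len\<beta> = primitiveD(1)[OF \<beta>]
  define E where "E = (\<lambda>a. R (vec_smult (hd a) \<beta>))"
  have E: "is_HS scale 1 (ray_index \<Delta> \<beta>) E"
    unfolding E_def by (rule isHS_restrict_ray[OF \<beta> R supp])
  then have psi: "isHS (psi \<beta> E)"
    by (rule isHS_psi[OF \<beta>])
  define F where "F = (\<lambda>\<gamma> x. series_solve (psi \<beta> E) (\<lambda>\<alpha>. R \<alpha> x) \<gamma>)"
  have series_comp: "series_comp (psi \<beta> E) F \<alpha> = R \<alpha>" if "\<alpha> \<in> \<Delta>" for \<alpha>
    using series_act_solve[OF psi that] by (simp add: series_comp_def F_def fun_eq_iff)
  have F: "isHS F"
    using isHS_left_divide[OF psi] isHS_cong[OF R] series_comp by simp
  have "F \<gamma> = (\<lambda>x. 0)" if "\<gamma> \<in> \<Delta>" "\<gamma> \<noteq> vec_zero q" "\<not> cone False \<beta> \<gamma>" for \<gamma>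
    using that
  proof (induction "sum_list \<gamma>" arbitrary: \<gamma> rule: less_induct)
    case less
    show ?case
    proof
      fix x
      let ?f = "\<lambda>\<delta> \<epsilon>. psi \<beta> E \<delta> (F \<epsilon> x)"
      have zero: "?f \<delta> \<epsilon> = 0"
        if s: "(\<delta>, \<epsilon>) \<in> splits \<gamma>" and \<delta>: "\<delta> \<noteq> vec_zero q" and \<epsilon>: "\<epsilon> \<noteq> vec_zero q" for \<delta> \<epsilon>
      proof (cases "\<exists>i. \<delta> = vec_smult i \<beta>")
        case True
        then obtain i where i: "\<delta> = vec_smult i \<beta>" ..
        have in\<Delta>: "\<delta> \<in> \<Delta>" "\<epsilon> \<in> \<Delta>"
          using in_splits[OF less.prems(1) s] by simp_all
        have "\<not> cone False \<beta> \<epsilon>"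
        proof
          assume "cone False \<beta> \<epsilon>"
          then have "cone False \<beta> (vec_add \<delta> \<epsilon>)"
            using cone_add[of True \<beta> \<delta> False \<epsilon>] i len\<beta> length_eq[OF in\<Delta>(2)] by simp
          then show False
            using splitsD(3)[OF s] less.prems(3) by simp
        qed
        moreover have "sum_list \<epsilon> < sum_list \<gamma>"
          using splits_sum_list_less[OF s] \<delta> length_eq[OF less.prems(1)] by simp
        ultimately have "F \<epsilon> = (\<lambda>x. 0)"
          using less.hyps in\<Delta>(2) \<epsilon> by blast
        then show ?thesis
          using klinearD(3)[OF isHS_klinear[OF psi in\<Delta>(1)]] by simp
      qed (simp add: psi_other[OF \<beta>])
      have "R \<gamma> x = (\<Sum>(\<delta>, \<epsilon>)\<in>{(vec_zero q, \<gamma>), (\<gamma>, vec_zero q)}. ?f \<delta> \<epsilon>)"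
        unfolding series_comp[OF less.prems(1), symmetric] series_comp_def series_act_def
      proof (intro sum.mono_neutral_right ballI)
        show "{(vec_zero q, \<gamma>), (\<gamma>, vec_zero q)} \<subseteq> splits \<gamma>"
          using length_eq[OF less.prems(1)] by (simp add: zero_splits splits_zero)
        fix p
        assume p: "p \<in> splits \<gamma> - {(vec_zero q, \<gamma>), (\<gamma>, vec_zero q)}"
        obtain \<delta> \<epsilon> where p_eq: "p = (\<delta>, \<epsilon>)"
          by (cases p)
        have "\<delta> \<noteq> vec_zero q" "\<epsilon> \<noteq> vec_zero q"
          using p p_eq splits_left_zero[of q \<epsilon> \<gamma>] splits_right_zero[of \<delta> q \<gamma>] by auto
        then show "(case p of (\<delta>, \<epsilon>) \<Rightarrow> ?f \<delta> \<epsilon>) = 0"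
          using p p_eq zero by simp
      qed simp
      also have "\<dots> = F \<gamma> x + psi \<beta> E \<gamma> x"
        using less.prems(2) isHS_zero[OF psi] isHS_zero[OF F] by simp
      finally have R\<gamma>: "R \<gamma> x = F \<gamma> x + psi \<beta> E \<gamma> x" .
      show "F \<gamma> x = 0"
      \<comment> \<open>On the ray the first and last terms of this equation agree by the choice of
        \<open>E\<close>; off the ray, \<gamma> is not even in the weak cone, and both are
        zero.\<close>
      proof (cases "\<exists>n. \<gamma> = vec_smult n \<beta>")
        case True
        then obtain n where "\<gamma> = vec_smult n \<beta>" ..
        then show ?thesis
          using R\<gamma> psi_smult[OF \<beta>, of E n] by (simp add: E_def)
      next
        case False
        then have "\<not> cone True \<beta> \<gamma>"
          using cone_True_cases[OF \<beta>] less.prems length_eq by blast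
        then show ?thesis
          using R\<gamma> psi_other[OF \<beta> False, of E] supp[OF less.prems(1)] by simp
      qed
    qed
  qed
  then show thesis
    using that E F series_comp by blast
qed

section \<open>Ordered products over finitely many rays\<close>

lemma isHS_ray_product: "(\<And>\<beta>. \<beta> \<in> set xs \<Longrightarrow> isHS (R \<beta>)) \<Longrightarrow> isHS (ray_product xs R)"
  by (induction xs) (simp_all add: isHS_one isHS_comp)

lemma ray_product_cong:
  "(\<And>\<beta> \<alpha>. \<beta> \<in> set xs \<Longrightarrow> \<alpha> \<in> \<Delta> \<Longrightarrow> R \<beta> \<alpha> = S \<beta> \<alpha>) \<Longrightarrow> \<alpha> \<in> \<Delta> \<Longrightarrow> ray_product xs R \<alpha> = ray_product xs S \<alpha>"
proof (induction xs arbitrary: \<alpha>)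
  case (Cons x xs)
  then show ?case
    by (simp, intro series_comp_cong) simp_all
qed simp

lemma ray_product_filter:
  "(\<And>\<beta> \<alpha>. \<beta> \<in> set xs \<Longrightarrow> \<not> P \<beta> \<Longrightarrow> \<alpha> \<in> \<Delta> \<Longrightarrow> R \<beta> \<alpha> = series_one \<alpha>) \<Longrightarrow> \<alpha> \<in> \<Delta> \<Longrightarrow>
    ray_product (filter P xs) R \<alpha> = ray_product xs R \<alpha>"
proof (induction xs arbitrary: \<alpha>)
  case (Cons x xs)
  have IH: "ray_product (filter P xs) R \<gamma> = ray_product xs R \<gamma>" if "\<gamma> \<in> \<Delta>" for \<gamma>
    using Cons.IH Cons.prems(1) that by simp
  show ?case
  proof (cases "P x")
    case True
    then show ?thesis
      using series_comp_cong[OF Cons.prems(2) refl IH] by simp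
  next
    case False
    have "series_comp (R x) (ray_product xs R) \<alpha> = series_comp series_one (ray_product (filter P xs) R) \<alpha>"
      using Cons.prems(1)[of x] False IH by (intro series_comp_cong[OF Cons.prems(2)]) simp_all
    then show ?thesis
      using False by (simp add: series_comp_one[OF Cons.prems(2)])
  qed
qed simp

text \<open>Every nonzero index contributed by the factors is a sum of positive multiples of vectors
  strictly above \<beta>, and the strict cone is closed under such sums.\<close>

lemma ray_product_support:
  assumes "set xs \<subseteq> primitive q" "length \<beta> = q"
    and "\<And>\<nu>. \<nu> \<in> set xs \<Longrightarrow> isHS (psi \<nu> (E \<nu>)) \<and> cone False \<beta> \<nu>"
    and "\<gamma> \<in> \<Delta>" "\<gamma> \<noteq> vec_zero q" "\<not> cone False \<beta> \<gamma>"
  shows "ray_product xs (\<lambda>\<nu>. psi \<nu> (E \<nu>)) \<gamma> = (\<lambda>x. 0)"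
  using assms(1,3-6)
proof (induction xs arbitrary: \<gamma>)
  case Nil
  then show ?case
    using length_eq[of \<gamma>] by (simp add: series_one_def)
next
  case (Cons \<nu> xs)
  let ?F = "ray_product xs (\<lambda>\<nu>. psi \<nu> (E \<nu>))"
  have \<nu>: "\<nu> \<in> primitive q" and psi: "isHS (psi \<nu> (E \<nu>))" and c: "cone False \<beta> \<nu>"
    using Cons.prems(1,2) by simp_all
  have "psi \<nu> (E \<nu>) \<delta> (?F \<epsilon> x) = 0" if s: "(\<delta>, \<epsilon>) \<in> splits \<gamma>" for \<delta> \<epsilon> x
  proof (cases "\<exists>i. \<delta> = vec_smult i \<nu>")
    case True
    then obtain i where i: "\<delta> = vec_smult i \<nu>" ..
    have in\<Delta>: "\<delta> \<in> \<Delta>" "\<epsilon> \<in> \<Delta>"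
      using in_splits[OF Cons.prems(3) s] by simp_all
    have len: "length \<nu> = q" "length \<delta> = q" "length \<epsilon> = q"
      using primitiveD(1)[OF \<nu>] length_eq in\<Delta> by simp_all
    have "\<epsilon> \<noteq> vec_zero q \<and> \<not> cone False \<beta> \<epsilon>"
    proof (rule ccontr)
      assume \<epsilon>: "\<not> (\<epsilon> \<noteq> vec_zero q \<and> \<not> cone False \<beta> \<epsilon>)"
      \<comment> \<open>The zero vector lies in the weak cone, so both alternatives for \<epsilon>
        can be treated at once. Strictness of the sum comes from \<delta>, unless \<delta> is itself
        zero.\<close>
      then have \<epsilon>': "cone True \<beta> \<epsilon>"
        using cone_zero[OF assms(2)] cone_mono by blast
      have "cone False \<beta> (vec_add \<delta> \<epsilon>)"
      proof (cases "i = 0")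
        case True
        then have "\<delta> = vec_zero q"
          using i smult_zero[OF len(1)] by simp
        moreover from this have "\<epsilon> = \<gamma>"
          using s splits_left_zero by blast
        ultimately show ?thesis
          using \<epsilon> Cons.prems(4,5) by blast
      next
        case False
        then have "cone False \<beta> \<delta>"
          using cone_scale[OF c] i len assms(2) by simp
        then show ?thesis
          using cone_add[of False \<beta> \<delta> True \<epsilon>] \<epsilon>' len assms(2) by simp
      qed
      then show False
        using splitsD(3)[OF s] Cons.prems(5) by simp
    qed
    then have "?F \<epsilon> = (\<lambda>x. 0)"
      using Cons.IH[OF _ _ in\<Delta>(2)] Cons.prems(1,2) by simp
    then show ?thesis
      using klinearD(3)[OF isHS_klinear[OF psi in\<Delta>(1)]] by simp
  qed (simp add: psi_other[OF \<nu>])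
  then show ?case
    by (auto simp: series_comp_def series_act_def fun_eq_iff intro!: sum.neutral)
qed

text \<open>All later factors together are supported at 0 and strictly above \<beta>, so only the
  leading factor reaches its own ray.\<close>

lemma ray_product_head:
  assumes "sorted_wrt (cone False) (\<beta> # xs)" "set (\<beta> # xs) \<subseteq> primitive q"
    and "\<And>\<nu>. \<nu> \<in> set (\<beta> # xs) \<Longrightarrow> isHS (psi \<nu> (E \<nu>))" "vec_smult n \<beta> \<in> \<Delta>"
  shows "ray_product (\<beta> # xs) (\<lambda>\<nu>. psi \<nu> (E \<nu>)) (vec_smult n \<beta>) = E \<beta> [n]"
proof -
  have "ray_product xs (\<lambda>\<nu>. psi \<nu> (E \<nu>)) \<gamma> = (\<lambda>x. 0)"
    if "\<gamma> \<in> \<Delta>" "\<gamma> \<noteq> vec_zero q" "\<not> cone False \<beta> \<gamma>" for \<gamma>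
    using assms that primitiveD(1)[of \<beta> q] by (intro ray_product_support[of xs \<beta>]) auto
  moreover have "isHS (ray_product xs (\<lambda>\<nu>. psi \<nu> (E \<nu>)))"
    using assms(3) by (intro isHS_ray_product) simp
  ultimately show ?thesis
    using assms by (simp add: series_comp_psi_smult)
qed

text \<open>The leading factor is forced because it can be read off from the product on its own ray;
  cancelling it on the left reduces to the shorter list.\<close>

lemma ray_product_unique:
  assumes "sorted_wrt (cone False) xs" "set xs \<subseteq> primitive q"
    and "\<And>\<nu>. \<nu> \<in> set xs \<Longrightarrow> isHS (psi \<nu> (E \<nu>))" "\<And>\<nu>. \<nu> \<in> set xs \<Longrightarrow> isHS (psi \<nu> (E' \<nu>))"
    and "\<And>\<alpha>. \<alpha> \<in> \<Delta> \<Longrightarrow> ray_product xs (\<lambda>\<nu>. psi \<nu> (E \<nu>)) \<alpha> = ray_product xs (\<lambda>\<nu>. psi \<nu> (E' \<nu>)) \<alpha>"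
    and "\<beta> \<in> set xs" "vec_smult n \<beta> \<in> \<Delta>"
  shows "E \<beta> [n] = E' \<beta> [n]"
  using assms
proof (induction xs)
  case (Cons \<nu> xs)
  have head: "E \<nu> [m] = E' \<nu> [m]" if "vec_smult m \<nu> \<in> \<Delta>" for m
    using ray_product_head[OF Cons.prems(1,2), of E m] ray_product_head[OF Cons.prems(1,2), of E' m]
      Cons.prems(3-5) that by metis
  show ?case
  proof (cases "\<beta> = \<nu>")
    case True
    then show ?thesis
      using head Cons.prems(7) by simp
  next
    case False
    have psi: "psi \<nu> (E \<nu>) \<alpha> = psi \<nu> (E' \<nu>) \<alpha>" if "\<alpha> \<in> \<Delta>" for \<alpha>
    proof (cases "\<exists>m. \<alpha> = vec_smult m \<nu>")
      case True
      then obtain m where m: "\<alpha> = vec_smult m \<nu>" ..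
      have "\<nu> \<in> primitive q"
        using Cons.prems(2) by simp
      then show ?thesis
        using head that by (simp only: m psi_smult)
    next
      case False
      have "\<nu> \<in> primitive q"
        using Cons.prems(2) by simp
      from psi_other[OF this False, of "E \<nu>"] psi_other[OF this False, of "E' \<nu>"] show ?thesis
        by simp
    qed
    have eq: "ray_product xs (\<lambda>\<nu>. psi \<nu> (E \<nu>)) \<alpha> = ray_product xs (\<lambda>\<nu>. psi \<nu> (E' \<nu>)) \<alpha>" if "\<alpha> \<in> \<Delta>" for \<alpha>
    proof (rule series_comp_cancel[OF _ _ that])
      show "isHS (psi \<nu> (E' \<nu>))"
        using Cons.prems(4) by simp
      fix \<alpha>
      assume "\<alpha> \<in> \<Delta>"
      then show "series_comp (psi \<nu> (E' \<nu>)) (ray_product xs (\<lambda>\<nu>. psi \<nu> (E \<nu>))) \<alpha> =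
          series_comp (psi \<nu> (E' \<nu>)) (ray_product xs (\<lambda>\<nu>. psi \<nu> (E' \<nu>))) \<alpha>"
        using Cons.prems(5)[of \<alpha>] series_comp_cong[of \<alpha> "psi \<nu> (E' \<nu>)" "psi \<nu> (E \<nu>)"] psi by simp
    qed
    show ?thesis
      using Cons.prems False by (intro Cons.IH eq) simp_all
  qed
qed simp

lemma ray_product_leading:
  assumes "sorted_wrt (cone False) (ys @ \<beta> # zs)" "set (ys @ \<beta> # zs) \<subseteq> primitive q"
    and "\<And>\<nu>. \<nu> \<in> set (ys @ \<beta> # zs) \<Longrightarrow> isHS (psi \<nu> (E \<nu>))"
    and "\<And>\<nu> m. \<nu> \<in> set ys \<Longrightarrow> 0 < m \<Longrightarrow> vec_smult m \<nu> \<in> \<Delta> \<Longrightarrow>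
      ray_product (ys @ \<beta> # zs) (\<lambda>\<nu>. psi \<nu> (E \<nu>)) (vec_smult m \<nu>) = (\<lambda>x. 0)"
    and "vec_smult n \<beta> \<in> \<Delta>"
  shows "E \<beta> [n] = ray_product (ys @ \<beta> # zs) (\<lambda>\<nu>. psi \<nu> (E \<nu>)) (vec_smult n \<beta>)"
  using assms
proof (induction ys)
  case Nil
  then show ?case
    using ray_product_head[of \<beta> zs E n] by simp
next
  case (Cons \<nu> ys)
  let ?F = "ray_product (ys @ \<beta> # zs) (\<lambda>\<nu>. psi \<nu> (E \<nu>))"
  have \<nu>: "\<nu> \<in> primitive q"
    using Cons.prems(2) by simp
  have psi: "isHS (psi \<nu> (E \<nu>))"
    using Cons.prems(3) by simp
  have "psi \<nu> (E \<nu>) \<alpha> = series_one \<alpha>" if \<alpha>: "\<alpha> \<in> \<Delta>" for \<alpha>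
  proof (cases "\<alpha> = vec_zero q")
    case True
    then show ?thesis
      using isHS_zero[OF psi] by (simp add: series_one_def)
  next
    case False
    have "psi \<nu> (E \<nu>) \<alpha> = (\<lambda>x. 0)"
    proof (cases "\<exists>m. \<alpha> = vec_smult m \<nu>")
      case True
      then obtain m where m: "\<alpha> = vec_smult m \<nu>" ..
      have "0 < m"
        using False m smult_zero[OF primitiveD(1)[OF \<nu>]] by (cases m) simp_all
      then have "E \<nu> [m] = (\<lambda>x. 0)"
        using ray_product_head[of \<nu> "ys @ \<beta> # zs" E m] Cons.prems(1-4) \<alpha> m by simp
      then show ?thesis
        by (simp only: m psi_smult[OF \<nu>])
    qed (simp add: psi_other[OF \<nu>])
    then show ?thesis
      using False length_eq[OF \<alpha>] by (simp add: series_one_def)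
  qed
  then have F: "ray_product ((\<nu> # ys) @ \<beta> # zs) (\<lambda>\<nu>. psi \<nu> (E \<nu>)) \<alpha> = ?F \<alpha>" if "\<alpha> \<in> \<Delta>" for \<alpha>
    using series_comp_cong[OF that, of "psi \<nu> (E \<nu>)" series_one ?F ?F] series_comp_one[OF that] by simp
  have "E \<beta> [n] = ?F (vec_smult n \<beta>)"
  proof (rule Cons.IH)
    show "?F (vec_smult m \<mu>) = (\<lambda>x. 0)" if "\<mu> \<in> set ys" "0 < m" "vec_smult m \<mu> \<in> \<Delta>" for \<mu> m
      using Cons.prems(4)[of \<mu> m] F[OF that(3)] that by simp
  qed (use Cons.prems in simp_all)
  then show ?case
    using F[OF Cons.prems(5)] by simp
qed

text \<open>The list \<open>ys\<close> records the rays already peeled off. It keeps the covering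
  hypothesis unchanged during the induction while the support of the remaining derivation shrinks to
  the rays of \<open>xs\<close>.\<close>

lemma ray_product_exists:
  assumes "sorted_wrt (cone False) (ys @ xs)" "set (ys @ xs) \<subseteq> primitive q" "isHS R"
    and cover: "\<And>\<gamma>. \<gamma> \<in> \<Delta> \<Longrightarrow> \<gamma> \<noteq> vec_zero q \<Longrightarrow> \<exists>\<beta>\<in>set (ys @ xs). \<exists>n. \<gamma> = vec_smult n \<beta>"
    and "\<And>\<gamma>. \<gamma> \<in> \<Delta> \<Longrightarrow> \<gamma> \<noteq> vec_zero q \<Longrightarrow> \<nexists>\<beta> n. \<beta> \<in> set xs \<and> \<gamma> = vec_smult n \<beta> \<Longrightarrow> R \<gamma> = (\<lambda>x. 0)"
  shows "\<exists>E. (\<forall>\<beta>\<in>set xs. is_HS scale 1 (ray_index \<Delta> \<beta>) (E \<beta>)) \<and>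
    (\<forall>\<alpha>\<in>\<Delta>. ray_product xs (\<lambda>\<nu>. psi \<nu> (E \<nu>)) \<alpha> = R \<alpha>)"
  using assms
proof (induction xs arbitrary: ys R)
  case Nil
  have "series_one \<alpha> = R \<alpha>" if "\<alpha> \<in> \<Delta>" for \<alpha>
    using Nil.prems(5)[OF that] isHS_zero[OF Nil.prems(3)] length_eq[OF that] by (auto simp: series_one_def)
  then show ?case
    by simp
next
  case (Cons \<beta> xs)
  have \<beta>: "\<beta> \<in> primitive q"
    using Cons.prems(2) by simp
  have pos: "0 < n" if "\<gamma> \<noteq> vec_zero q" "\<gamma> = vec_smult n \<nu>" "\<nu> \<in> set (ys @ \<beta> # xs)" for \<gamma> \<nu> n
  proof (rule ccontr)
    assume "\<not> 0 < n"
    moreover have "length \<nu> = q"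
      using that(3) Cons.prems(2) primitiveD(1) by blast
    ultimately show False
      using that(1,2) smult_zero by simp
  qed
  have "R \<gamma> = (\<lambda>x. 0)" if \<gamma>: "\<gamma> \<in> \<Delta>" "\<not> cone True \<beta> \<gamma>" for \<gamma>
  proof (rule Cons.prems(5)[OF \<gamma>(1)])
    show nz: "\<gamma> \<noteq> vec_zero q"
      using \<gamma>(2) cone_zero[OF primitiveD(1)[OF \<beta>]] by auto
    show "\<nexists>\<nu> n. \<nu> \<in> set (\<beta> # xs) \<and> \<gamma> = vec_smult n \<nu>"
    proof
      assume "\<exists>\<nu> n. \<nu> \<in> set (\<beta> # xs) \<and> \<gamma> = vec_smult n \<nu>"
      then obtain \<nu> n where \<nu>: "\<nu> \<in> set (\<beta> # xs)" "\<gamma> = vec_smult n \<nu>"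
        by blast
      then have n: "0 < n"
        using pos[OF nz \<nu>(2)] \<nu>(1) by auto
      have "\<nu> \<noteq> \<beta>"
        using \<nu>(2) \<gamma>(2) cone_smult[of True \<beta> n] by auto
      then have "\<nu> \<in> set xs"
        using \<nu>(1) by simp
      then have "cone False \<beta> \<nu>" "length \<nu> = q"
        using Cons.prems(1,2) primitiveD(1) by (auto simp: sorted_wrt_append)
      then have "cone False \<beta> \<gamma>"
        using cone_scale[of \<beta> \<nu> n] n \<nu>(2) primitiveD(1)[OF \<beta>] by simp
      then show False
        using \<gamma>(2) cone_mono by blast
    qed
  qed
  then obtain E0 F where E0: "is_HS scale 1 (ray_index \<Delta> \<beta>) E0" and F: "isHS F"
    and series_comp: "\<And>\<alpha>. \<alpha> \<in> \<Delta> \<Longrightarrow> series_comp (psi \<beta> E0) F \<alpha> = R \<alpha>"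
    and supp: "\<And>\<gamma>. \<gamma> \<in> \<Delta> \<Longrightarrow> \<gamma> \<noteq> vec_zero q \<Longrightarrow> \<not> cone False \<beta> \<gamma> \<Longrightarrow> F \<gamma> = (\<lambda>x. 0)"
    using peel_smallest_ray[OF \<beta> Cons.prems(3)] by blast
  have "\<exists>E. (\<forall>\<beta>\<in>set xs. is_HS scale 1 (ray_index \<Delta> \<beta>) (E \<beta>)) \<and>
    (\<forall>\<alpha>\<in>\<Delta>. ray_product xs (\<lambda>\<nu>. psi \<nu> (E \<nu>)) \<alpha> = F \<alpha>)"
  proof (rule Cons.IH[of "ys @ [\<beta>]", OF _ _ F])
    fix \<gamma>
    assume \<gamma>: "\<gamma> \<in> \<Delta>" "\<gamma> \<noteq> vec_zero q" "\<nexists>\<nu> n. \<nu> \<in> set xs \<and> \<gamma> = vec_smult n \<nu>"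
    obtain \<nu> n where \<nu>: "\<nu> \<in> set (ys @ \<beta> # xs)" "\<gamma> = vec_smult n \<nu>"
      using Cons.prems(4)[OF \<gamma>(1,2)] by blast
    have len: "length \<nu> = q" "length \<beta> = q" "length \<gamma> = q"
      using primitiveD(1)[OF subsetD[OF Cons.prems(2) \<nu>(1)]] primitiveD(1)[OF \<beta>] length_eq[OF \<gamma>(1)]
      by simp_all
    \<comment> \<open>A vector on a ray that is not in \<open>xs\<close> lies on the ray of \<beta>
      or of a smaller vector. It is therefore not strictly above \<beta>, and the quotient
      \<open>F\<close> vanishes there.\<close>
    have "\<nu> = \<beta> \<or> \<nu> \<in> set ys"
      using \<gamma>(3) \<nu> by auto
    then have le: "\<nu> = \<beta> \<or> cone False \<nu> \<beta>"
      using Cons.prems(1) by (auto simp: sorted_wrt_append)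
    have "\<not> cone False \<beta> \<gamma>"
    proof
      assume "cone False \<beta> \<gamma>"
      then have "cone False \<nu> \<gamma>"
        using le cone_trans[of \<nu> \<beta> \<gamma>] len by auto
      then show False
        using \<nu>(2) by simp
    qed
    then show "F \<gamma> = (\<lambda>x. 0)"
      using supp[OF \<gamma>(1,2)] by simp
  qed (use Cons.prems in simp_all)
  then obtain E where E: "\<forall>\<beta>\<in>set xs. is_HS scale 1 (ray_index \<Delta> \<beta>) (E \<beta>)"
    and prod: "\<And>\<alpha>. \<alpha> \<in> \<Delta> \<Longrightarrow> ray_product xs (\<lambda>\<nu>. psi \<nu> (E \<nu>)) \<alpha> = F \<alpha>"
    by blast
  let ?E = "E(\<beta> := E0)"
  have notin: "\<beta> \<notin> set xs"
    using Cons.prems(1) cone_irrefl by (auto simp: sorted_wrt_append)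
  have prod': "ray_product xs (\<lambda>\<nu>. psi \<nu> (?E \<nu>)) \<alpha> = F \<alpha>" if "\<alpha> \<in> \<Delta>" for \<alpha>
    unfolding prod[OF that, symmetric] using notin that by (intro ray_product_cong) auto
  show ?case
  proof (intro exI[of _ ?E] conjI ballI)
    show "is_HS scale 1 (ray_index \<Delta> \<nu>) (?E \<nu>)" if "\<nu> \<in> set (\<beta> # xs)" for \<nu>
      using that E E0 by auto
    show "ray_product (\<beta> # xs) (\<lambda>\<nu>. psi \<nu> (?E \<nu>)) \<alpha> = R \<alpha>" if "\<alpha> \<in> \<Delta>" for \<alpha>
      using series_comp[OF that] series_comp_cong[OF that refl prod'] by simp
  qed
qed

end

section \<open>Gluing over finite co-ideals\<close>

lemma sorted_wrt_cone_exists: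
  assumes "finite S" "S \<subseteq> primitive q"
  shows "\<exists>xs. set xs = S \<and> sorted_wrt (cone False) xs"
  using assms
proof (induction S rule: finite_induct)
  case (insert x S)
  then obtain xs where xs: "set xs = S" "sorted_wrt (cone False) xs"
    by auto
  \<comment> \<open>The new element serves as a pivot; totality on primitive vectors guarantees that
    the two filters lose nothing.\<close>
  let ?ys = "filter (\<lambda>y. cone False y x) xs @ x # filter (\<lambda>y. cone False x y) xs"
  have len: "length y = q" if "y \<in> insert x S" for y
    using that insert.prems primitiveD(1) by blast
  have "set ?ys = insert x S"
  proof -
    have "cone False y x \<or> cone False x y" if "y \<in> S" for y
      using primitive_cone_total[of y q x] that insert by auto
    then show ?thesis
      using xs(1) by auto
  qed
  moreover have "cone False y z" if "y \<in> S" "cone False y x" "z \<in> S" "cone False x z" for y z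
    using cone_trans[of y x z] that len by simp
  then have "sorted_wrt (cone False) ?ys"
    using xs by (auto simp: sorted_wrt_append sorted_wrt_filter)
  ultimately show ?case
    by blast
qed simp

lemma sorted_wrt_cone_unique:
  assumes "sorted_wrt (cone False) xs" "sorted_wrt (cone False) ys" "set xs = set ys"
    and "set ys \<subseteq> primitive q"
  shows "xs = ys"
  using assms
proof (induction xs arbitrary: ys)
  case (Cons x xs)
  then obtain y zs where ys: "ys = y # zs"
    by (cases ys) auto
  have len: "length z = q" if "z \<in> set ys" for z
    using that Cons.prems(4) primitiveD(1) by blast
  have "x = y"
  proof (rule ccontr)
    assume "x \<noteq> y"
    then have "x \<in> set zs" "y \<in> set xs"
      using Cons.prems(3) ys by auto
    then have "cone False x y" "cone False y x"
      using Cons.prems(1,2) ys by auto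
    then have "cone False x x"
      using cone_trans[of x y x] len \<open>x \<in> set zs\<close> ys by simp
    then show False
      using cone_irrefl by blast
  qed
  moreover have "x \<notin> set xs" "y \<notin> set zs"
    using Cons.prems(1,2) ys cone_irrefl by auto
  ultimately have "set xs = set zs"
    using Cons.prems(3) ys by auto
  then show ?case
    using Cons.IH[of zs] Cons.prems ys \<open>x = y\<close> by simp
qed simp

lemma sorted_wrt_prec_iff:
  assumes "2 \<le> q" "set xs \<subseteq> primitive q"
  shows "sorted_wrt prec xs \<longleftrightarrow> sorted_wrt (cone False) xs"
proof -
  have "prec x y = cone False x y" if "x \<in> set xs" "y \<in> set xs" for x y
  proof -
    have "x \<in> primitive q" "y \<in> primitive q"
      using that assms(2) by auto
    then show ?thesis
      using prec_iff_cone[of x y] primitiveD[of x q] primitiveD[of y q] assms(1) by simp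
  qed
  then show ?thesis
    by (auto intro: sorted_wrt_mono_rel[rotated])
qed

text \<open>Since \<Delta> is closed downwards, the n with n\<beta> in \<Delta> form an initial
  segment, so counting the positive ones gives the largest of them, or infinity if all
  occur.\<close>

lemma ray_card_iff:
  assumes "coideal q \<Delta>" "\<beta> \<in> primitive q" "\<Delta> \<noteq> {}"
  shows "enat n \<le> ray_card \<Delta> \<beta> \<longleftrightarrow> vec_smult n \<beta> \<in> \<Delta>"
proof -
  define S where "S = {n. 0 < n \<and> vec_smult n \<beta> \<in> \<Delta>}"
  have ray: "ray \<Delta> \<beta> = (\<lambda>n. vec_smult n \<beta>) ` S"
    by (auto simp: ray_def S_def)
  have inj: "inj_on (\<lambda>n. vec_smult n \<beta>) S"
    using inj_vec_smult[OF primitiveD(2)[OF assms(2)]] by (rule inj_on_subset) simp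
  have card: "ray_card \<Delta> \<beta> = (if finite S then enat (card S) else \<infinity>)"
    unfolding ray_card_def ray by (simp add: finite_image_iff[OF inj] card_image[OF inj])
  have down: "vec_smult m \<beta> \<in> \<Delta>" if "vec_smult n \<beta> \<in> \<Delta>" "m \<le> n" for m n
    using assms(1) that vec_le_smult unfolding coideal_def by blast
  show ?thesis
  proof
    assume n: "vec_smult n \<beta> \<in> \<Delta>"
    then have "{1..n} \<subseteq> S"
      using down by (auto simp: S_def)
    then have "n \<le> card S" if "finite S"
      using card_mono[OF that, of "{1..n}"] by simp
    then show "enat n \<le> ray_card \<Delta> \<beta>"
      by (simp add: card)
  next
    assume le: "enat n \<le> ray_card \<Delta> \<beta>"
    show "vec_smult n \<beta> \<in> \<Delta>"
    proof (rule ccontr)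
      assume n: "vec_smult n \<beta> \<notin> \<Delta>"
      then have "n \<noteq> 0"
        using coideal_zero[OF assms(1,3)] smult_zero[OF primitiveD(1)[OF assms(2)]] by (cases n) simp_all
      have "S \<subseteq> {1..<n}"
      proof
        fix m
        assume "m \<in> S"
        then have "0 < m" "\<not> n \<le> m"
          using n down[of m n] by (simp_all add: S_def) blast
        then show "m \<in> {1..<n}"
          by simp
      qed
      then have "finite S" "card S \<le> n - 1"
        using finite_subset card_mono[of "{1..<n}" S] by auto
      then show False
        using le card \<open>n \<noteq> 0\<close> by simp
    qed
  qed
qed

abbreviation box :: "nat list \<Rightarrow> nat list set" where
  "box \<alpha> \<equiv> {\<gamma>. vec_le \<gamma> \<alpha>}"

lemma coideal_box: "length \<alpha> = q \<Longrightarrow> coideal q (box \<alpha>)"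
  by (auto simp: coideal_def list_all2_lengthD intro: vec_le_trans)

text \<open>For finite \<Delta> the choice is harmless: a strictly increasing enumeration of
  primitive vectors is unique. This also makes the lists for nested co-ideals compatible.\<close>

definition primitive_list :: "nat \<Rightarrow> nat list set \<Rightarrow> nat list list" where
  "primitive_list q \<Delta> = (SOME xs. set xs = primitive q \<inter> \<Delta> \<and> sorted_wrt (cone False) xs)"

lemma primitive_list:
  assumes "finite \<Delta>"
  shows "set (primitive_list q \<Delta>) = primitive q \<inter> \<Delta>" "sorted_wrt (cone False) (primitive_list q \<Delta>)"
proof -
  have "\<exists>xs. set xs = primitive q \<inter> \<Delta> \<and> sorted_wrt (cone False) xs"
    using assms by (intro sorted_wrt_cone_exists[of _ q]) auto
  from someI_ex[OF this] show "set (primitive_list q \<Delta>) = primitive q \<inter> \<Delta>"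
    "sorted_wrt (cone False) (primitive_list q \<Delta>)"
    by (simp_all add: primitive_list_def)
qed

lemma primitive_list_filter:
  assumes "finite \<Delta>" "\<Delta>' \<subseteq> \<Delta>"
  shows "primitive_list q \<Delta>' = filter (\<lambda>\<beta>. \<beta> \<in> \<Delta>') (primitive_list q \<Delta>)"
  using assms finite_subset[OF assms(2,1)]
  by (intro sorted_wrt_cone_unique[of _ _ q]) (auto simp: primitive_list sorted_wrt_filter)

lemma restrict_eq_iff: "restrict f A = restrict g A \<longleftrightarrow> (\<forall>x\<in>A. f x = g x)"
  by (metis restrict_apply' restrict_ext)

lemma HS_one_eq: "HS_one \<Delta> = restrict series_one \<Delta>"
  by (simp add: HS_one_def series_one_def restrict_def fun_eq_iff)

text \<open>Each condition on \<open>D\<close> concerns one index at a time, so it may be checked on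
  any set containing that index; nonemptiness supplies the condition at 0.\<close>

lemma is_HS_local:
  assumes "\<Delta> \<noteq> {}" "\<And>\<alpha>. \<alpha> \<in> \<Delta> \<Longrightarrow> \<exists>\<Delta>'. \<alpha> \<in> \<Delta>' \<and> is_HS scale q \<Delta>' D"
  shows "is_HS scale q \<Delta> D"
  unfolding is_HS_def using assms by (metis ex_in_conv is_HS_def)

context coideal_algebra
begin

abbreviation HS_family where
  "HS_family E \<equiv> \<forall>\<beta>\<in>primitive q \<inter> \<Delta>. is_HS scale 1 (ray_index \<Delta> \<beta>) (E \<beta>)"

lemma ray_index_down: "vec_smult n \<beta> \<in> \<Delta> \<Longrightarrow> m \<le> n \<Longrightarrow> vec_smult m \<beta> \<in> \<Delta>"
  using coideal vec_le_smult unfolding coideal_def by blast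

lemma coideal_ray_index: "coideal 1 (ray_index \<Delta> \<beta>)"
  unfolding coideal_def by (auto simp: list_all2_Cons2) (rule ray_index_down)

lemma HS_family_psi: "HS_family E \<Longrightarrow> \<beta> \<in> primitive q \<inter> \<Delta> \<Longrightarrow> isHS (psi \<beta> (E \<beta>))"
  by (simp add: isHS_psi)

lemma HS_family_zero: "HS_family E \<Longrightarrow> \<beta> \<in> primitive q \<inter> \<Delta> \<Longrightarrow> E \<beta> [0] = id"
  by (auto simp: is_HS_def)

text \<open>A positive multiple of \<beta> dominates \<beta>, so a co-ideal without \<beta> contains
  none of them and sees the factor only at 0.\<close>

lemma psi_trivial:
  assumes "coideal q \<Delta>'" "\<beta> \<in> primitive q" "\<beta> \<notin> \<Delta>'" "E \<beta> [0] = id" "\<alpha> \<in> \<Delta>'"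
  shows "psi \<beta> (E \<beta>) \<alpha> = series_one \<alpha>"
proof (cases "\<alpha> = vec_zero q")
  case True
  then show ?thesis
    using psi_smult[OF assms(2), of "E \<beta>" 0] smult_zero[OF primitiveD(1)[OF assms(2)]] assms(4)
    by (simp add: series_one_def)
next
  case False
  have "\<nexists>n. \<alpha> = vec_smult n \<beta>"
  proof
    assume "\<exists>n. \<alpha> = vec_smult n \<beta>"
    then obtain n where n: "\<alpha> = vec_smult n \<beta>" ..
    then have "n \<noteq> 0"
      using False smult_zero[OF primitiveD(1)[OF assms(2)]] by (cases n) simp_all
    then have "vec_le (vec_smult 1 \<beta>) \<alpha>"
      unfolding n by (intro vec_le_smult) simp
    then have "vec_le \<beta> \<alpha>"
      by (simp add: map_idI)
    then show False
      using assms(1,3,5) unfolding coideal_def by blast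
  qed
  then show ?thesis
    using psi_other[OF assms(2), of \<alpha> "E \<beta>"] False coideal_length[OF assms(1,5)] by (simp add: series_one_def)
qed

lemma ray_product_list_mono:
  assumes "finite \<Delta>" "coideal q \<Delta>'" "\<Delta>' \<noteq> {}" "\<Delta>' \<subseteq> \<Delta>" "HS_family E" "\<alpha> \<in> \<Delta>'"
  shows "ray_product (primitive_list q \<Delta>') (\<lambda>\<nu>. psi \<nu> (E \<nu>)) \<alpha> = ray_product (primitive_list q \<Delta>) (\<lambda>\<nu>. psi \<nu> (E \<nu>)) \<alpha>"
proof -
  interpret sub: coideal_algebra scale q \<Delta>'
    using assms by unfold_locales
  show ?thesis
    unfolding primitive_list_filter[OF assms(1,4)]
  proof (rule sub.ray_product_filter[OF _ assms(6)])
    fix \<beta> \<alpha>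
    assume "\<beta> \<in> set (primitive_list q \<Delta>)" "\<beta> \<notin> \<Delta>'" "\<alpha> \<in> \<Delta>'"
    then show "psi \<beta> (E \<beta>) \<alpha> = series_one \<alpha>"
      using psi_trivial[OF assms(2)] HS_family_zero[OF assms(5)] primitive_list[OF assms(1)] by blast
  qed
qed

text \<open>Splittings of an element of a co-ideal stay inside it, so truncating each factor gives
  the same as truncating the product.\<close>

lemma foldr_HS_comp:
  "foldr (\<lambda>i. HS_comp \<Delta> (restrict (R i) \<Delta>)) xs (HS_one \<Delta>) = restrict (ray_product xs R) \<Delta>"
proof (induction xs)
  case Nil
  show ?case
    by (simp add: HS_one_eq)
next
  case (Cons x xs)
  have "HS_comp \<Delta> (restrict (R x) \<Delta>) (restrict (ray_product xs R) \<Delta>) \<alpha> = series_comp (R x) (ray_product xs R) \<alpha>"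
    if "\<alpha> \<in> \<Delta>" for \<alpha>
  proof -
    have "series_comp (restrict (R x) \<Delta>) (restrict (ray_product xs R) \<Delta>) \<alpha> = series_comp (R x) (ray_product xs R) \<alpha>"
      using that by (intro series_comp_cong) simp_all
    then show ?thesis
      using that by (simp add: HS_comp_def series_comp_def series_act_def fun_eq_iff)
  qed
  moreover have "HS_comp \<Delta> (restrict (R x) \<Delta>) (restrict (ray_product xs R) \<Delta>) \<alpha> = undefined"
    if "\<alpha> \<notin> \<Delta>" for \<alpha>
    using that by (simp add: HS_comp_def)
  ultimately have "HS_comp \<Delta> (restrict (R x) \<Delta>) (restrict (ray_product xs R) \<Delta>) = restrict (series_comp (R x) (ray_product xs R)) \<Delta>"
    by (intro ext) (simp add: restrict_def)
  then show ?case
    by (simp only: foldr.simps o_apply Cons.IH ray_product_simps)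
qed

lemma box_subset: "\<alpha> \<in> \<Delta> \<Longrightarrow> box \<alpha> \<subseteq> \<Delta>"
  using coideal by (auto simp: coideal_def)

lemma box_algebra: "\<alpha> \<in> \<Delta> \<Longrightarrow> coideal_algebra scale q (box \<alpha>)"
  using coideal_box[OF length_eq] vec_le_refl by unfold_locales blast+

end

section \<open>Ordered compositions over arbitrary co-ideals\<close>

locale HS_factorization = coideal_algebra scale q \<Delta>
  for scale :: "'k::{comm_ring, comm_monoid_mult} \<Rightarrow> 'a::{comm_ring, comm_monoid_mult} \<Rightarrow> 'a"
    and q \<Delta> +
  assumes two_le: "2 \<le> q"
begin

text \<open>The possibly infinite composition, defined diagonally: its component at \<alpha> is
  taken from the finite product over the box below \<alpha>. By \<open>product_eq\<close>, any
  finite co-ideal inside \<Delta> containing \<alpha> gives the same value.\<close>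

abbreviation product where
  "product E \<alpha> \<equiv> ray_product (primitive_list q (box \<alpha>)) (\<lambda>\<nu>. psi \<nu> (E \<nu>)) \<alpha>"

abbreviation psi_family where
  "psi_family E \<equiv> \<lambda>\<beta>. psi_act \<Delta> \<beta> (E \<beta>)"

lemma HS_family_sub:
  assumes "\<Delta>' \<subseteq> \<Delta>" "HS_family E" "\<beta> \<in> primitive q \<inter> \<Delta>'"
  shows "is_HS scale 1 (ray_index \<Delta>' \<beta>) (E \<beta>)"
proof (rule is_HS_mono)
  show "is_HS scale 1 (ray_index \<Delta> \<beta>) (E \<beta>)"
    using assms by blast
qed (use assms in auto)

lemma product_eq:
  assumes "finite \<Delta>'" "coideal q \<Delta>'" "\<Delta>' \<subseteq> \<Delta>" "HS_family E" "\<alpha> \<in> \<Delta>'"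
  shows "product E \<alpha> = ray_product (primitive_list q \<Delta>') (\<lambda>\<nu>. psi \<nu> (E \<nu>)) \<alpha>"
proof -
  interpret sub: coideal_algebra scale q \<Delta>'
    using assms by unfold_locales auto
  have "length \<alpha> = q"
    using assms length_eq by blast
  then show ?thesis
    using assms HS_family_sub vec_le_refl
    by (intro sub.ray_product_list_mono coideal_box sub.box_subset ballI) blast+
qed

lemma isHS_product:
  assumes "HS_family E"
  shows "isHS (product E)"
proof (rule is_HS_local[OF nonempty])
  fix \<alpha>
  assume \<alpha>: "\<alpha> \<in> \<Delta>"
  interpret sub: coideal_algebra scale q "box \<alpha>"
    by (rule box_algebra[OF \<alpha>])
  have box: "finite (box \<alpha>)" "coideal q (box \<alpha>)" "box \<alpha> \<subseteq> \<Delta>"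
    using finite_vec_le coideal_box[OF length_eq[OF \<alpha>]] box_subset[OF \<alpha>] by simp_all
  have "is_HS scale q (box \<alpha>) (ray_product (primitive_list q (box \<alpha>)) (\<lambda>\<nu>. psi \<nu> (E \<nu>)))"
  proof (rule sub.isHS_ray_product)
    fix \<beta>
    assume "\<beta> \<in> set (primitive_list q (box \<alpha>))"
    then have "\<beta> \<in> primitive q \<inter> box \<alpha>"
      using primitive_list(1)[OF box(1)] by simp
    then show "is_HS scale q (box \<alpha>) (psi \<beta> (E \<beta>))"
      using HS_family_sub[OF box(3) assms] by (intro sub.isHS_psi) auto
  qed
  then have "is_HS scale q (box \<alpha>) (product E)"
    by (rule sub.isHS_cong) (rule product_eq[OF box assms, symmetric])
  then show "\<exists>\<Delta>'. \<alpha> \<in> \<Delta>' \<and> is_HS scale q \<Delta>' (product E)"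
    by (intro exI[of _ "box \<alpha>"]) (simp add: vec_le_refl)
qed

lemma nontrivial_on_psi_family:
  assumes "\<Delta>' \<subseteq> \<Delta>"
  shows "nontrivial_on \<Delta>' (primitive q \<inter> \<Delta>) (psi_family E) =
    {\<beta> \<in> primitive q \<inter> \<Delta>. \<exists>\<alpha>\<in>\<Delta>'. psi \<beta> (E \<beta>) \<alpha> \<noteq> series_one \<alpha>}"
proof -
  have "restrict (psi_act \<Delta> \<beta> (E \<beta>)) \<Delta>' = HS_one \<Delta>' \<longleftrightarrow> (\<forall>\<alpha>\<in>\<Delta>'. psi \<beta> (E \<beta>) \<alpha> = series_one \<alpha>)" for \<beta>
  proof -
    have "psi_act \<Delta> \<beta> (E \<beta>) \<alpha> = psi \<beta> (E \<beta>) \<alpha>" if "\<alpha> \<in> \<Delta>'" for \<alpha>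
      using assms that by (intro psi_act_eq) blast
    then show ?thesis
      by (simp add: HS_one_eq restrict_eq_iff)
  qed
  then show ?thesis
    by (auto simp: nontrivial_on_def)
qed

lemma nontrivial_on_subset:
  assumes "\<Delta>' \<subseteq> \<Delta>" "coideal q \<Delta>'" "HS_family E"
  shows "nontrivial_on \<Delta>' (primitive q \<inter> \<Delta>) (psi_family E) \<subseteq> primitive q \<inter> \<Delta>'"
  unfolding nontrivial_on_psi_family[OF assms(1)]
  using psi_trivial[OF assms(2)] HS_family_zero[OF assms(3)] by blast

text \<open>The increasing list of nontrivial indices exists and is unique, so the existential
  reduces to one product. The primitive vectors of \<Delta>' missing from that list belong to
  factors that are trivial on \<Delta>', so the product may run over all of them.\<close>

lemma composition_iff:
  assumes "finite \<Delta>'" "coideal q \<Delta>'" "\<Delta>' \<noteq> {}" "\<Delta>' \<subseteq> \<Delta>" "HS_family E"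
  shows "(\<exists>xs. set xs = nontrivial_on \<Delta>' (primitive q \<inter> \<Delta>) (psi_family E) \<and> sorted_wrt prec xs \<and>
      restrict D \<Delta>' = foldr (\<lambda>i. HS_comp \<Delta>' (restrict (psi_family E i) \<Delta>')) xs (HS_one \<Delta>')) \<longleftrightarrow>
    (\<forall>\<alpha>\<in>\<Delta>'. D \<alpha> = product E \<alpha>)"
proof -
  interpret sub: coideal_algebra scale q \<Delta>'
    using assms by unfold_locales
  define N where "N = nontrivial_on \<Delta>' (primitive q \<inter> \<Delta>) (psi_family E)"
  define xs where "xs = filter (\<lambda>\<beta>. \<beta> \<in> N) (primitive_list q \<Delta>')"
  have N: "N \<subseteq> primitive q \<inter> \<Delta>'"
    unfolding N_def by (rule nontrivial_on_subset[OF assms(4,2,5)])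
  have xs: "set xs = N" "sorted_wrt (cone False) xs"
    using N primitive_list[OF assms(1)] by (auto simp: xs_def sorted_wrt_filter)
  have unique: "ys = xs" if "set ys = N" "sorted_wrt prec ys" for ys
    using that N xs sorted_wrt_prec_iff[OF two_le, of ys]
    by (intro sorted_wrt_cone_unique[of ys xs q]) auto
  have sorted: "sorted_wrt prec xs"
    using xs N sorted_wrt_prec_iff[OF two_le, of xs] by simp
  have "ray_product xs (psi_family E) \<alpha> = product E \<alpha>" if \<alpha>: "\<alpha> \<in> \<Delta>'" for \<alpha>
  proof -
    have "ray_product xs (psi_family E) \<alpha> = ray_product xs (\<lambda>\<nu>. psi \<nu> (E \<nu>)) \<alpha>"
      using assms(4) \<alpha> psi_act_eq by (intro sub.ray_product_cong) blast+
    also have "\<dots> = ray_product (primitive_list q \<Delta>') (\<lambda>\<nu>. psi \<nu> (E \<nu>)) \<alpha>"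
      unfolding xs_def
    proof (rule sub.ray_product_filter[OF _ \<alpha>])
      fix \<beta> \<gamma>
      assume "\<beta> \<in> set (primitive_list q \<Delta>')" "\<beta> \<notin> N" "\<gamma> \<in> \<Delta>'"
      then show "psi \<beta> (E \<beta>) \<gamma> = series_one \<gamma>"
        using assms(4) primitive_list(1)[OF assms(1)] unfolding N_def nontrivial_on_psi_family[OF assms(4)] by blast
    qed
    also have "\<dots> = product E \<alpha>"
      using product_eq[OF assms(1,2,4,5) \<alpha>] by simp
    finally show ?thesis .
  qed
  then have main: "restrict D \<Delta>' = foldr (\<lambda>i. HS_comp \<Delta>' (restrict (psi_family E i) \<Delta>')) xs (HS_one \<Delta>') \<longleftrightarrow>
      (\<forall>\<alpha>\<in>\<Delta>'. D \<alpha> = product E \<alpha>)"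
    unfolding sub.foldr_HS_comp restrict_eq_iff by simp
  show ?thesis
    unfolding N_def[symmetric] main[symmetric]
    by (rule iffI, elim exE conjE, drule (1) unique, simp)
      (intro exI[of _ xs] conjI xs(1) sorted)
qed

lemma ordered_comp_eq:
  assumes "HS_family E"
  shows "ordered_comp scale q \<Delta> prec (primitive q \<inter> \<Delta>) (psi_family E) = restrict (product E) \<Delta>"
proof -
  let ?P = "\<lambda>D. D \<in> HS scale q \<Delta> \<and>
     (\<forall>\<Delta>'. coideal q \<Delta>' \<and> finite \<Delta>' \<and> \<Delta>' \<noteq> {} \<and> \<Delta>' \<subseteq> \<Delta> \<longrightarrow>
        (\<exists>xs. set xs = nontrivial_on \<Delta>' (primitive q \<inter> \<Delta>) (psi_family E) \<and> sorted_wrt prec xs \<and>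
           restrict D \<Delta>' = foldr (\<lambda>i. HS_comp \<Delta>' (restrict (psi_family E i) \<Delta>')) xs (HS_one \<Delta>')))"
  have "isHS (restrict (product E) \<Delta>)"
    by (rule isHS_cong[OF isHS_product[OF assms]]) simp
  moreover have "\<forall>\<alpha>\<in>\<Delta>'. restrict (product E) \<Delta> \<alpha> = product E \<alpha>" if "\<Delta>' \<subseteq> \<Delta>" for \<Delta>'
    using that by (simp add: subsetD)
  ultimately have "?P (restrict (product E) \<Delta>)"
    unfolding HS_iff
    by (intro conjI allI impI restrict_extensional composition_iff[OF _ _ _ _ assms, THEN iffD2]) blast+
  moreover have "D = restrict (product E) \<Delta>" if D: "?P D" for D
  proof
    fix \<alpha>
    show "D \<alpha> = restrict (product E) \<Delta> \<alpha>"
    proof (cases "\<alpha> \<in> \<Delta>")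
      case True
      \<comment> \<open>The box below \<alpha> is the smallest co-ideal that sees the component at
        \<alpha>, and it already determines this component of any candidate.\<close>
      have box: "finite (box \<alpha>)" "coideal q (box \<alpha>)" "box \<alpha> \<noteq> {}" "box \<alpha> \<subseteq> \<Delta>"
        using finite_vec_le coideal_box[OF length_eq[OF True]] box_subset[OF True] vec_le_refl by blast+
      then have "\<forall>\<gamma>\<in>box \<alpha>. D \<gamma> = product E \<gamma>"
        using D composition_iff[OF box assms, of D] by blast
      then show ?thesis
        using True vec_le_refl by simp
    next
      case False
      then show ?thesis
        using D by (simp add: HS_def extensional_def)
    qed
  qed
  ultimately show ?thesis
    unfolding ordered_comp_def by (rule the_equality)
qed

lemma HS1_iff:
  assumes "\<beta> \<in> primitive q"
  shows "E \<in> HS1 scale (ray_card \<Delta> \<beta>) \<longleftrightarrow>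
    E \<in> extensional (ray_index \<Delta> \<beta>) \<and> is_HS scale 1 (ray_index \<Delta> \<beta>) E"
  by (simp add: HS1_def HS_iff ray_card_iff[OF coideal assms nonempty])

lemma composable_psi_family:
  assumes "HS_family E"
  shows "composable scale q \<Delta> (primitive q \<inter> \<Delta>) (psi_family E)"
  unfolding composable_def
proof (intro conjI ballI allI impI)
  fix \<beta>
  assume "\<beta> \<in> primitive q \<inter> \<Delta>"
  then have "isHS (psi \<beta> (E \<beta>))"
    by (rule HS_family_psi[OF assms])
  then have "isHS (psi_family E \<beta>)"
    by (rule isHS_cong) (rule psi_act_eq[symmetric])
  then show "psi_family E \<beta> \<in> HS scale q \<Delta>"
    by (simp add: HS_iff psi_act_def)
next
  fix \<Delta>'
  assume "coideal q \<Delta>' \<and> finite \<Delta>' \<and> \<Delta>' \<subseteq> \<Delta>"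
  then show "finite (nontrivial_on \<Delta>' (primitive q \<inter> \<Delta>) (psi_family E))"
    using nontrivial_on_subset[OF _ _ assms] finite_subset by (metis finite_Int)
qed

lemma is_factorization_iff:
  assumes "D \<in> HS scale q \<Delta>"
  shows "is_factorization scale q \<Delta> D E \<longleftrightarrow>
    E \<in> (\<Pi>\<^sub>E \<beta>\<in>primitive q \<inter> \<Delta>. HS1 scale (ray_card \<Delta> \<beta>)) \<and> HS_family E \<and>
    (\<forall>\<alpha>\<in>\<Delta>. D \<alpha> = product E \<alpha>)"
proof -
  have HS_family: "HS_family E" if "E \<in> (\<Pi>\<^sub>E \<beta>\<in>primitive q \<inter> \<Delta>. HS1 scale (ray_card \<Delta> \<beta>))"
    using that HS1_iff by (auto simp: PiE_iff)
  have eq: "D = restrict (product E) \<Delta> \<longleftrightarrow> (\<forall>\<alpha>\<in>\<Delta>. D \<alpha> = product E \<alpha>)"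
    using assms by (auto simp: HS_iff extensional_def restrict_def fun_eq_iff)
  show ?thesis
  proof (cases "E \<in> (\<Pi>\<^sub>E \<beta>\<in>primitive q \<inter> \<Delta>. HS1 scale (ray_card \<Delta> \<beta>))")
    case True
    note g = HS_family[OF True]
    show ?thesis
      unfolding is_factorization_def ordered_comp_eq[OF g] eq using True g composable_psi_family[OF g] by fast
  qed (simp add: is_factorization_def)
qed

section \<open>Existence, uniqueness and leading components of the factorization\<close>

lemma box_facts:
  assumes "\<alpha> \<in> \<Delta>"
  shows "finite (box \<alpha>)" "coideal q (box \<alpha>)" "box \<alpha> \<noteq> {}" "box \<alpha> \<subseteq> \<Delta>"
  using finite_vec_le coideal_box[OF length_eq[OF assms]] box_subset[OF assms] vec_le_refl by blast+

text \<open>The positivity of n puts \<beta> itself into the box below n\<beta>, so its factor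
  occurs in the finite product there and uniqueness for lists applies.\<close>

lemma box_factors_unique:
  assumes "\<beta> \<in> primitive q" "0 < n" "vec_smult n \<beta> \<in> \<Delta>"
    and E: "\<And>\<nu>. \<nu> \<in> primitive q \<inter> box (vec_smult n \<beta>) \<Longrightarrow>
      is_HS scale 1 (ray_index (box (vec_smult n \<beta>)) \<nu>) (E \<nu>)"
    and E': "\<And>\<nu>. \<nu> \<in> primitive q \<inter> box (vec_smult n \<beta>) \<Longrightarrow>
      is_HS scale 1 (ray_index (box (vec_smult n \<beta>)) \<nu>) (E' \<nu>)"
    and eq: "\<And>\<alpha>. \<alpha> \<in> box (vec_smult n \<beta>) \<Longrightarrow>
      ray_product (primitive_list q (box (vec_smult n \<beta>))) (\<lambda>\<nu>. psi \<nu> (E \<nu>)) \<alpha> =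
      ray_product (primitive_list q (box (vec_smult n \<beta>))) (\<lambda>\<nu>. psi \<nu> (E' \<nu>)) \<alpha>"
  shows "E \<beta> [n] = E' \<beta> [n]"
proof -
  let ?B = "box (vec_smult n \<beta>)"
  note B = box_facts[OF assms(3)]
  interpret sub: coideal_algebra scale q ?B
    by (rule box_algebra[OF assms(3)])
  have "vec_le (vec_smult 1 \<beta>) (vec_smult n \<beta>)"
    using assms(2) by (intro vec_le_smult) simp
  then have "\<beta> \<in> set (primitive_list q ?B)"
    using primitive_list(1)[OF B(1)] assms(1) by (simp add: map_idI)
  then show ?thesis
    using primitive_list(1)[OF B(1)] E E' vec_le_refl
    by (intro sub.ray_product_unique[OF primitive_list(2)[OF B(1)] _ _ _ eq] sub.isHS_psi) auto
qed

lemma box_factors_exist: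
  assumes "isHS D" "\<alpha> \<in> \<Delta>"
  shows "\<exists>E. (\<forall>\<beta>\<in>primitive q \<inter> box \<alpha>. is_HS scale 1 (ray_index (box \<alpha>) \<beta>) (E \<beta>)) \<and>
    (\<forall>\<gamma>\<in>box \<alpha>. ray_product (primitive_list q (box \<alpha>)) (\<lambda>\<nu>. psi \<nu> (E \<nu>)) \<gamma> = D \<gamma>)"
proof -
  note B = box_facts[OF assms(2)]
  interpret sub: coideal_algebra scale q "box \<alpha>"
    by (rule box_algebra[OF assms(2)])
  note set = primitive_list(1)[OF B(1), of q]
  \<comment> \<open>The primitive vector on the ray of \<gamma> is dominated by \<gamma>, so it lies
    in the same box.\<close>
  have cover: "\<exists>\<beta>\<in>set (primitive_list q (box \<alpha>)). \<exists>n. \<gamma> = vec_smult n \<beta>"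
    if \<gamma>: "\<gamma> \<in> box \<alpha>" "\<gamma> \<noteq> vec_zero q" for \<gamma>
  proof -
    obtain \<beta> n where \<beta>: "\<beta> \<in> primitive q" "0 < n" "\<gamma> = vec_smult n \<beta>"
      using multiple_of_primitive[OF sub.length_eq[OF \<gamma>(1)] \<gamma>(2)] .
    have "vec_le (vec_smult 1 \<beta>) (vec_smult n \<beta>)"
      using \<beta>(2) by (intro vec_le_smult) simp
    then have "vec_le \<beta> \<gamma>"
      by (simp add: map_idI \<beta>(3))
    then have "\<beta> \<in> box \<alpha>"
      using \<gamma>(1) vec_le_trans by blast
    then show ?thesis
      using \<beta> set by blast
  qed
  have "\<exists>E. (\<forall>\<beta>\<in>set (primitive_list q (box \<alpha>)). is_HS scale 1 (ray_index (box \<alpha>) \<beta>) (E \<beta>)) \<and>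
    (\<forall>\<gamma>\<in>box \<alpha>. ray_product (primitive_list q (box \<alpha>)) (\<lambda>\<nu>. psi \<nu> (E \<nu>)) \<gamma> = D \<gamma>)"
  proof (rule sub.ray_product_exists[of "[]"])
    show "is_HS scale q (box \<alpha>) D"
      by (rule is_HS_mono[OF assms(1) B(4)])
    fix \<gamma>
    assume \<gamma>: "\<gamma> \<in> box \<alpha>" "\<gamma> \<noteq> vec_zero q"
    show "\<exists>\<beta>\<in>set ([] @ primitive_list q (box \<alpha>)). \<exists>n. \<gamma> = vec_smult n \<beta>"
      using cover[OF \<gamma>] by simp
    assume "\<nexists>\<beta> n. \<beta> \<in> set (primitive_list q (box \<alpha>)) \<and> \<gamma> = vec_smult n \<beta>"
    then show "D \<gamma> = (\<lambda>x. 0)"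
      using cover[OF \<gamma>] by blast
  qed (use primitive_list[OF B(1)] in simp_all)
  then show ?thesis
    by (simp only: set)
qed

lemma factorization_unique:
  assumes "D \<in> HS scale q \<Delta>" "is_factorization scale q \<Delta> D E" "is_factorization scale q \<Delta> D E'"
  shows "E = E'"
proof -
  note E = assms(2)[unfolded is_factorization_iff[OF assms(1)]]
  note E' = assms(3)[unfolded is_factorization_iff[OF assms(1)]]
  have eq: "E \<beta> [n] = E' \<beta> [n]" if \<beta>: "\<beta> \<in> primitive q \<inter> \<Delta>" and n: "vec_smult n \<beta> \<in> \<Delta>" for \<beta> n
  proof (cases "n = 0")
    \<comment> \<open>The box below 0 contains no primitive vector and says nothing about degree 0;
      there both components are the identity by definition.\<close>
    case True
    then show ?thesis
      using HS_family_zero[OF _ \<beta>] E E' by simp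
  next
    case False
    note B = box_facts[OF n]
    show ?thesis
    proof (rule box_factors_unique)
      fix \<alpha>
      assume \<alpha>: "\<alpha> \<in> box (vec_smult n \<beta>)"
      then have "\<alpha> \<in> \<Delta>"
        using B(4) by blast
      then have "product E \<alpha> = product E' \<alpha>"
        using E E' by simp
      then show "ray_product (primitive_list q (box (vec_smult n \<beta>))) (\<lambda>\<nu>. psi \<nu> (E \<nu>)) \<alpha> =
          ray_product (primitive_list q (box (vec_smult n \<beta>))) (\<lambda>\<nu>. psi \<nu> (E' \<nu>)) \<alpha>"
        using product_eq[OF B(1,2,4) _ \<alpha>] E E' by simp
    qed (use \<beta> n False HS_family_sub[OF B(4)] E E' in auto)
  qed
  show ?thesis
  proof (rule PiE_ext)
    show "E \<in> (\<Pi>\<^sub>E \<beta>\<in>primitive q \<inter> \<Delta>. HS1 scale (ray_card \<Delta> \<beta>))"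
      "E' \<in> (\<Pi>\<^sub>E \<beta>\<in>primitive q \<inter> \<Delta>. HS1 scale (ray_card \<Delta> \<beta>))"
      using E E' by simp_all
    fix \<beta>
    assume \<beta>: "\<beta> \<in> primitive q \<inter> \<Delta>"
    then have "E \<beta> \<in> extensional (ray_index \<Delta> \<beta>)" "E' \<beta> \<in> extensional (ray_index \<Delta> \<beta>)"
      using E E' HS1_iff[of \<beta>] by (auto simp: PiE_iff)
    then show "E \<beta> = E' \<beta>"
    proof (rule extensionalityI)
      fix a
      assume "a \<in> ray_index \<Delta> \<beta>"
      then show "E \<beta> a = E' \<beta> a"
        using eq[OF \<beta>] by blast
    qed
  qed
qed

lemma factorization_exists:
  assumes D: "D \<in> HS scale q \<Delta>"
  shows "\<exists>E. is_factorization scale q \<Delta> D E"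
proof -
  have "isHS D"
    using D by (simp add: HS_iff)
  then have "\<forall>\<alpha>\<in>\<Delta>. \<exists>E. (\<forall>\<beta>\<in>primitive q \<inter> box \<alpha>. is_HS scale 1 (ray_index (box \<alpha>) \<beta>) (E \<beta>)) \<and>
    (\<forall>\<gamma>\<in>box \<alpha>. ray_product (primitive_list q (box \<alpha>)) (\<lambda>\<nu>. psi \<nu> (E \<nu>)) \<gamma> = D \<gamma>)"
    using box_factors_exist by blast
  then obtain F where
    F: "\<And>\<alpha> \<beta>. \<alpha> \<in> \<Delta> \<Longrightarrow> \<beta> \<in> primitive q \<inter> box \<alpha> \<Longrightarrow> is_HS scale 1 (ray_index (box \<alpha>) \<beta>) (F \<alpha> \<beta>)"
    and prod: "\<And>\<alpha> \<gamma>. \<alpha> \<in> \<Delta> \<Longrightarrow> \<gamma> \<in> box \<alpha> \<Longrightarrow>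
      ray_product (primitive_list q (box \<alpha>)) (\<lambda>\<nu>. psi \<nu> (F \<alpha> \<nu>)) \<gamma> = D \<gamma>"
    unfolding bchoice_iff by blast
  \<comment> \<open>The n-th component at \<beta> is taken from the box below n\<beta>, the smallest
    one in which it is visible. Degree 0 is set by hand, because the box below 0 does not contain
    \<beta>. The restrictions make the family extensional.\<close>
  define E where "E = (\<lambda>\<beta>\<in>primitive q \<inter> \<Delta>. \<lambda>a\<in>ray_index \<Delta> \<beta>.
      if a = [0] then id else F (vec_smult (hd a) \<beta>) \<beta> a)"
  \<comment> \<open>All boxes agree: the factors over the box below \<alpha>, seen on the smaller
    box below n\<beta>, factorize \<open>D\<close> there too, so uniqueness identifies the
    components.\<close>
  have E_eq: "E \<beta> [n] = F \<alpha> \<beta> [n]"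
    if \<alpha>: "\<alpha> \<in> \<Delta>" and \<beta>: "\<beta> \<in> primitive q \<inter> box \<alpha>" and n: "vec_smult n \<beta> \<in> box \<alpha>" for \<alpha> \<beta> n
  proof -
    note A = box_facts[OF \<alpha>]
    interpret sub: coideal_algebra scale q "box \<alpha>"
      by (rule box_algebra[OF \<alpha>])
    have F_family: "sub.HS_family (F \<alpha>)"
      using F[OF \<alpha>] by blast
    have in\<Delta>: "\<beta> \<in> \<Delta>" "vec_smult n \<beta> \<in> \<Delta>"
      using \<beta> n A(4) by blast+
    then have E1: "E \<beta> [n] = (if n = 0 then id else F (vec_smult n \<beta>) \<beta> [n])"
      using \<beta> by (auto simp: E_def)
    show ?thesis
    proof (cases "n = 0")
      case True
      then show ?thesis
        using E1 sub.HS_family_zero[OF F_family \<beta>] by simp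
    next
      case False
      note B = box_facts[OF in\<Delta>(2)]
      have sub: "box (vec_smult n \<beta>) \<subseteq> box \<alpha>"
        by (rule sub.box_subset[OF n])
      have "F (vec_smult n \<beta>) \<beta> [n] = F \<alpha> \<beta> [n]"
      proof (rule box_factors_unique[where E = "F (vec_smult n \<beta>)" and E' = "F \<alpha>"])
        show "is_HS scale 1 (ray_index (box (vec_smult n \<beta>)) \<nu>) (F (vec_smult n \<beta>) \<nu>)"
          if "\<nu> \<in> primitive q \<inter> box (vec_smult n \<beta>)" for \<nu>
          by (rule F[OF in\<Delta>(2) that])
        show "is_HS scale 1 (ray_index (box (vec_smult n \<beta>)) \<nu>) (F \<alpha> \<nu>)"
          if "\<nu> \<in> primitive q \<inter> box (vec_smult n \<beta>)" for \<nu>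
          by (rule is_HS_mono[OF F[OF \<alpha>]]) (use that sub in blast)+
        fix \<gamma>
        assume \<gamma>: "\<gamma> \<in> box (vec_smult n \<beta>)"
        show "ray_product (primitive_list q (box (vec_smult n \<beta>))) (\<lambda>\<nu>. psi \<nu> (F (vec_smult n \<beta>) \<nu>)) \<gamma> =
          ray_product (primitive_list q (box (vec_smult n \<beta>))) (\<lambda>\<nu>. psi \<nu> (F \<alpha> \<nu>)) \<gamma>"
          using prod[OF in\<Delta>(2) \<gamma>] prod[OF \<alpha>, of \<gamma>] sub \<gamma>
            sub.ray_product_list_mono[OF A(1) B(2,3) sub F_family \<gamma>] by (metis subsetD)
      qed (use \<beta> False in\<Delta> in auto)
      then show ?thesis
        using E1 False by simp
    qed
  qed
  have HS_family: "is_HS scale 1 (ray_index \<Delta> \<beta>) (E \<beta>)" if \<beta>: "\<beta> \<in> primitive q \<inter> \<Delta>" for \<beta>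
  proof (rule is_HS_local)
    have "vec_smult 0 \<beta> \<in> \<Delta>"
      using zero_in \<beta> smult_zero[of \<beta> q] primitiveD(1)[of \<beta> q] by simp
    then show "ray_index \<Delta> \<beta> \<noteq> {}"
      by blast
    fix a
    assume "a \<in> ray_index \<Delta> \<beta>"
    then obtain n where n: "a = [n]" "vec_smult n \<beta> \<in> \<Delta>"
      by blast
    \<comment> \<open>The maximum ensures that \<beta> lies in the chosen box even for n =
      0.\<close>
    define m where "m = max 1 n"
    have m: "vec_smult m \<beta> \<in> \<Delta>"
      using n \<beta> by (cases "n = 0") (simp_all add: m_def max_def map_idI)
    have le: "vec_le (vec_smult 1 \<beta>) (vec_smult m \<beta>)" "vec_le (vec_smult n \<beta>) (vec_smult m \<beta>)"
      by (intro vec_le_smult, simp add: m_def)+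
    then have \<beta>B: "\<beta> \<in> primitive q \<inter> box (vec_smult m \<beta>)"
      using \<beta> by (simp add: map_idI)
    interpret sub: coideal_algebra scale q "box (vec_smult m \<beta>)"
      by (rule box_algebra[OF m])
    interpret ray: coideal_algebra scale 1 "ray_index (box (vec_smult m \<beta>)) \<beta>"
      using sub.coideal_ray_index vec_le_refl by unfold_locales blast+
    have "is_HS scale 1 (ray_index (box (vec_smult m \<beta>)) \<beta>) (E \<beta>)"
    proof (rule ray.isHS_cong[OF F[OF m \<beta>B]])
      fix b
      assume "b \<in> ray_index (box (vec_smult m \<beta>)) \<beta>"
      then show "F (vec_smult m \<beta>) \<beta> b = E \<beta> b"
        using E_eq[OF m \<beta>B] by auto
    qed
    moreover have "a \<in> ray_index (box (vec_smult m \<beta>)) \<beta>"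
      using n(1) le(2) by blast
    ultimately show "\<exists>\<Delta>'. a \<in> \<Delta>' \<and> is_HS scale 1 \<Delta>' (E \<beta>)"
      by (intro exI[of _ "ray_index (box (vec_smult m \<beta>)) \<beta>"] conjI)
  qed
  have "D \<alpha> = product E \<alpha>" if \<alpha>: "\<alpha> \<in> \<Delta>" for \<alpha>
  proof -
    note B = box_facts[OF \<alpha>]
    interpret sub: coideal_algebra scale q "box \<alpha>"
      by (rule box_algebra[OF \<alpha>])
    have "\<alpha> \<in> box \<alpha>"
      using vec_le_refl by blast
    then have "ray_product (primitive_list q (box \<alpha>)) (\<lambda>\<nu>. psi \<nu> (E \<nu>)) \<alpha> = ray_product (primitive_list q (box \<alpha>)) (\<lambda>\<nu>. psi \<nu> (F \<alpha> \<nu>)) \<alpha>"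
    proof (rule sub.ray_product_cong[rotated])
      fix \<beta> \<gamma>
      assume "\<beta> \<in> set (primitive_list q (box \<alpha>))" and \<gamma>: "\<gamma> \<in> box \<alpha>"
      then have \<beta>: "\<beta> \<in> primitive q \<inter> box \<alpha>"
        using primitive_list(1)[OF B(1)] by blast
      then have prim: "\<beta> \<in> primitive q"
        by blast
      show "psi \<beta> (E \<beta>) \<gamma> = psi \<beta> (F \<alpha> \<beta>) \<gamma>"
      proof (cases "\<exists>n. \<gamma> = vec_smult n \<beta>")
        case True
        then obtain n where n: "\<gamma> = vec_smult n \<beta>" ..
        show ?thesis
          using E_eq[OF \<alpha> \<beta>, of n] \<gamma> unfolding n psi_smult[OF prim] by blast
      next
        case False
        then show ?thesis
          using psi_other[OF prim False, of "E \<beta>"] psi_other[OF prim False, of "F \<alpha> \<beta>"] by simp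
      qed
    qed
    then show ?thesis
      using prod[OF \<alpha> \<open>\<alpha> \<in> box \<alpha>\<close>] by simp
  qed
  moreover have "E \<in> (\<Pi>\<^sub>E \<beta>\<in>primitive q \<inter> \<Delta>. HS1 scale (ray_card \<Delta> \<beta>))"
  proof (rule PiE_I)
    fix \<beta>
    assume \<beta>: "\<beta> \<in> primitive q \<inter> \<Delta>"
    then have "E \<beta> \<in> extensional (ray_index \<Delta> \<beta>)"
      by (simp add: E_def)
    then show "E \<beta> \<in> HS1 scale (ray_card \<Delta> \<beta>)"
      using HS_family[OF \<beta>] HS1_iff[of \<beta>] \<beta> by blast
  qed (auto simp: E_def)
  ultimately show ?thesis
    using HS_family is_factorization_iff[OF D] by blast
qed

text \<open>Everything takes place in the box below \<alpha>, where only vectors dominated by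
  \<alpha> matter. With \<alpha> = m\<beta> the gcd of \<alpha> is m, so the range of n consists of
  those multiples of \<beta> that lie in the box.\<close>

lemma factorization_leading:
  assumes D: "D \<in> HS scale q \<Delta>" and fact: "is_factorization scale q \<Delta> D E"
    and \<beta>: "\<beta> \<in> primitive q \<inter> \<Delta>" and \<alpha>: "\<alpha> \<in> ray \<Delta> \<beta>"
    and vanish: "\<And>\<gamma>. \<gamma> \<in> below q \<Delta> \<beta> \<Longrightarrow> vec_le \<gamma> \<alpha> \<Longrightarrow> D \<gamma> = (\<lambda>x. 0)"
    and n: "n \<le> Gcd (set \<alpha>)"
  shows "E \<beta> [n] = D (vec_smult n \<beta>)"
proof -
  note E = fact[unfolded is_factorization_iff[OF D]]
  obtain m where m: "0 < m" "\<alpha> = vec_smult m \<beta>" and \<alpha>\<Delta>: "\<alpha> \<in> \<Delta>"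
    using \<alpha> by (auto simp: ray_def)
  have "Gcd (set \<alpha>) = m"
    using \<beta> by (simp add: m(2) Gcd_mult primitive_def)
  then have le: "vec_le (vec_smult n \<beta>) \<alpha>"
    using n unfolding m(2) by (intro vec_le_smult) simp
  have "vec_le (vec_smult 1 \<beta>) \<alpha>"
    unfolding m(2) using m(1) by (intro vec_le_smult) simp
  then have \<beta>B: "vec_le \<beta> \<alpha>"
    by (simp add: map_idI)
  note B = box_facts[OF \<alpha>\<Delta>]
  interpret sub: coideal_algebra scale q "box \<alpha>"
    by (rule box_algebra[OF \<alpha>\<Delta>])
  have prod: "ray_product (primitive_list q (box \<alpha>)) (\<lambda>\<nu>. psi \<nu> (E \<nu>)) \<gamma> = D \<gamma>" if "\<gamma> \<in> box \<alpha>" for \<gamma>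
  proof -
    have "product E \<gamma> = D \<gamma>"
      using E that B(4) by force
    then show ?thesis
      using product_eq[OF B(1,2,4) _ that] E by simp
  qed
  have set: "set (primitive_list q (box \<alpha>)) = primitive q \<inter> box \<alpha>"
    by (rule primitive_list(1)[OF B(1)])
  then obtain ys zs where ys: "primitive_list q (box \<alpha>) = ys @ \<beta> # zs"
    using \<beta> \<beta>B split_list[of \<beta> "primitive_list q (box \<alpha>)"] by blast
  have "E \<beta> [n] = ray_product (ys @ \<beta> # zs) (\<lambda>\<nu>. psi \<nu> (E \<nu>)) (vec_smult n \<beta>)"
  proof (rule sub.ray_product_leading)
    show "sorted_wrt (cone False) (ys @ \<beta> # zs)" "set (ys @ \<beta> # zs) \<subseteq> primitive q"
      using primitive_list(2)[OF B(1), of q] set ys by auto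
    show "vec_smult n \<beta> \<in> box \<alpha>"
      using le by simp
    show "is_HS scale q (box \<alpha>) (psi \<nu> (E \<nu>))" if "\<nu> \<in> set (ys @ \<beta> # zs)" for \<nu>
      using that set ys E HS_family_sub[OF B(4), of E \<nu>] by (intro sub.isHS_psi) auto
    fix \<nu> k
    assume \<nu>: "\<nu> \<in> set ys" and k: "0 < k" "vec_smult k \<nu> \<in> box \<alpha>"
    have \<nu>B: "\<nu> \<in> primitive q \<inter> box \<alpha>"
      using \<nu> set ys by auto
    have "cone False \<nu> \<beta>"
      using primitive_list(2)[OF B(1), of q] \<nu> ys by (auto simp: sorted_wrt_append)
    then have "prec \<nu> \<beta>"
      using sorted_wrt_prec_iff[OF two_le, of "[\<nu>, \<beta>]"] \<nu>B \<beta> by simp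
    moreover have "vec_smult k \<nu> \<in> ray \<Delta> \<nu>"
      using k B(4) by (auto simp: ray_def)
    ultimately have "vec_smult k \<nu> \<in> below q \<Delta> \<beta>"
      using \<nu>B B(4) by (auto simp: below_def)
    then show "ray_product (ys @ \<beta> # zs) (\<lambda>\<nu>. psi \<nu> (E \<nu>)) (vec_smult k \<nu>) = (\<lambda>x. 0)"
      using prod[OF k(2)] vanish k(2) ys by simp
  qed
  then show ?thesis
    using prod[of "vec_smult n \<beta>"] le ys by simp
qed

end

theorem corollary3p5:
  fixes scale :: "'k::{comm_ring, comm_monoid_mult} \<Rightarrow> 'a::{comm_ring, comm_monoid_mult} \<Rightarrow> 'a"
    and q :: nat and \<Delta> :: "nat list set" and D :: "nat list \<Rightarrow> 'a \<Rightarrow> 'a"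
  assumes "comm_algebra scale"
    and "2 \<le> q"
    and "coideal q \<Delta>"
    and "\<Delta> \<noteq> {}"
    and "\<Delta> \<noteq> {vec_zero q}"
    and "D \<in> HS scale q \<Delta>"
  shows "(\<exists>!E. is_factorization scale q \<Delta> D E) \<and>
    (\<forall>E. is_factorization scale q \<Delta> D E \<longrightarrow>
      (\<forall>\<beta>\<in>primitive q \<inter> \<Delta>. \<forall>\<alpha>\<in>ray \<Delta> \<beta>.
        (\<forall>\<gamma>\<in>below q \<Delta> \<beta>. vec_le \<gamma> \<alpha> \<longrightarrow> D \<gamma> = (\<lambda>x. 0)) \<longrightarrow>
        (\<forall>n\<in>{0..Gcd (set \<alpha>)}. E \<beta> [n] = D (vec_smult n \<beta>))))"
proof -
  interpret comm_algebra scale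
    by (rule assms(1))
  interpret HS_factorization scale q \<Delta>
    using assms by unfold_locales
  show ?thesis
    using factorization_exists[OF assms(6)] factorization_unique[OF assms(6)]
      factorization_leading[OF assms(6)] by auto
qed

end
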